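(* Let $m\ge 2$ be an integer with $m\equiv 0$ or $1 \pmod 4$. Then the triangular graph $T(m)$ is class 1, and if moreover $m\neq 5$, the complement of $T(m)$ is also class 1.
   Context: The triangular graph $T(m)$ is the line graph of the complete graph $K_m$: its vertices are the $2$-subsets of an $m$-set, two being adjacent if they intersect in exactly one element. A graph of maximum degree $\Delta$ is class 1 if its chromatic index (minimum number of colours in a proper edge-colouring, i.e. one in which edges sharing a vertex get different colours) equals $\Delta$. *)

theory Defs
  imports Main
begin

(* Undirected graphs; an edge is the two-element set of its end vertices. *)
datatype 'a ugraph = Graph (verts: "'a set") (edges: "'a set set")

definition simple_graph :: "'a ugraph \<Rightarrow> bool" where
  "simple_graph G \<longleftrightarrow>
     finite (verts G) \<and> (\<forall>e\<in>edges G. e \<subseteq> verts G \<and> card e = 2)"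

definition complete_graph :: "'a set \<Rightarrow> 'a ugraph" where
  "complete_graph X = Graph X {e. e \<subseteq> X \<and> card e = 2}"

definition line_graph :: "'a ugraph \<Rightarrow> 'a set ugraph" where
  "line_graph G = Graph (edges G)
     {{e, f} | e f. e \<in> edges G \<and> f \<in> edges G \<and> e \<noteq> f \<and> e \<inter> f \<noteq> {}}"

definition graph_complement :: "'a ugraph \<Rightarrow> 'a ugraph" where
  "graph_complement G = Graph (verts G)
     {e. e \<subseteq> verts G \<and> card e = 2 \<and> e \<notin> edges G}"

definition triangular_graph :: "nat \<Rightarrow> nat set ugraph" where
  "triangular_graph m = line_graph (complete_graph {..<m})"

definition degree :: "'a ugraph \<Rightarrow> 'a \<Rightarrow> nat" where
  "degree G v = card {e \<in> edges G. v \<in> e}"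

(* Meaningful for finite graphs with at least one vertex. *)
definition max_degree :: "'a ugraph \<Rightarrow> nat" where
  "max_degree G = Max (degree G ` verts G)"

definition proper_edge_colouring :: "'a ugraph \<Rightarrow> ('a set \<Rightarrow> 'c) \<Rightarrow> bool" where
  "proper_edge_colouring G c \<longleftrightarrow>
     (\<forall>e\<in>edges G. \<forall>f\<in>edges G. e \<noteq> f \<and> e \<inter> f \<noteq> {} \<longrightarrow> c e \<noteq> c f)"

definition chromatic_index :: "'a ugraph \<Rightarrow> nat" where
  "chromatic_index G =
     (LEAST k. \<exists>c. proper_edge_colouring G c \<and> c ` edges G \<subseteq> {..<k})"

definition class_1 :: "'a ugraph \<Rightarrow> bool" where
  "class_1 G \<longleftrightarrow> chromatic_index G = max_degree G"

lemma verts_triangular_graph: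
  "verts (triangular_graph m) = {e. e \<subseteq> {..<m} \<and> card e = 2}"
  by (simp add: triangular_graph_def line_graph_def complete_graph_def)

lemma card_2_Int_eq_1_iff:
  assumes "card e = 2" "card f = 2"
  shows "card (e \<inter> f) = 1 \<longleftrightarrow> e \<noteq> f \<and> e \<inter> f \<noteq> {}"
proof
  assume 1: "card (e \<inter> f) = 1"
  then have "e \<noteq> f" using assms by auto
  moreover have "e \<inter> f \<noteq> {}" using 1 by force
  ultimately show "e \<noteq> f \<and> e \<inter> f \<noteq> {}" ..
next
  assume *: "e \<noteq> f \<and> e \<inter> f \<noteq> {}"
  have fin: "finite e" "finite f"
    using assms by (simp_all add: card_ge_0_finite)
  have "card (e \<inter> f) \<noteq> 0"
    using * fin by simp
  moreover have "card (e \<inter> f) \<noteq> 2"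
  proof
    assume "card (e \<inter> f) = 2"
    then have "e \<inter> f = e" "e \<inter> f = f"
      using assms fin by (simp_all add: card_subset_eq)
    with * show False by simp
  qed
  moreover have "card (e \<inter> f) \<le> 2"
    using card_mono[of e "e \<inter> f"] fin assms by simp
  ultimately show "card (e \<inter> f) = 1" by linarith
qed

lemma edges_triangular_graph:
  "edges (triangular_graph m) =
     {{e, f} | e f. e \<in> verts (triangular_graph m) \<and> f \<in> verts (triangular_graph m)
        \<and> card (e \<inter> f) = 1}"
proof -
  have "e \<in> V \<and> f \<in> V \<and> e \<noteq> f \<and> e \<inter> f \<noteq> {} \<longleftrightarrow>
        e \<in> V \<and> f \<in> V \<and> card (e \<inter> f) = 1"
    if "V = verts (triangular_graph m)" for e f V
    using card_2_Int_eq_1_iff[of e f] unfolding that verts_triangular_graph by blast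
  then show ?thesis
    by (simp add: triangular_graph_def line_graph_def)
qed

lemma simple_graph_triangular_graph: "simple_graph (triangular_graph m)"
proof -
  have "finite (verts (triangular_graph m))"
    by (rule finite_subset[of _ "Pow {..<m}"]) (auto simp: verts_triangular_graph)
  then show ?thesis
    by (auto simp: simple_graph_def triangular_graph_def line_graph_def card_2_iff)
qed

lemma simple_graph_graph_complement:
  "simple_graph G \<Longrightarrow> simple_graph (graph_complement G)"
  by (auto simp: simple_graph_def graph_complement_def)

end

theory Submission
  imports Defs
begin

text \<open>
  Let \<open>N = 2 n + 1\<close> be the odd one among \<open>m\<close> and \<open>m - 1\<close>, and decompose the complete graph on \<open>N\<close> points
  into \<open>n\<close> Hamiltonian cycles. The edges of each cycle form a block of \<open>N\<close> vertices of the triangular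
  graph; if \<open>m = N + 1\<close>, the pairs through the additional point form one more block. The congruence on
  \<open>m\<close> says exactly that the number of blocks is even, so the pairs of blocks split into rounds that are
  perfect matchings of the set of blocks. It remains to colour, for one pair of blocks, the regular
  bipartite graph between them together with the edges assigned to this pair inside the two blocks.

  Without inner edges this is Koenig's theorem. The inner edges are organised in Hamiltonian cycles of odd
  length \<open>N\<close>, one in each block. Two such cycles and an \<open>r\<close>-regular bipartite graph between them can be coloured
  with \<open>r + 2\<close> colours, provided that the bipartite graph has a perfect matching sending the ends of
  some edge of one cycle to the ends of an edge of the other. Between a cycle block and the additional
  block, such a matching sends the edges of the cycle to their first points. Between two cycle blocks it
  comes from Hall's theorem and an expansion property of the bipartite graph; only the complement for
  \<open>N = 7\<close> needs an explicit one.

  In the triangular graph the inner edges of a block form a single cycle. For odd \<open>m\<close> all of these are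
  spent in one round; for even \<open>m\<close> the additional block is a clique, which splits into the given
  Hamiltonian cycles, and block \<open>b\<close> is treated in the round that pairs it with this clique. In the
  complement the inner edges of a cycle block form \<open>n - 1\<close> Hamiltonian cycles, one for every other
  cycle block, and the additional block has no inner edges.
\<close>

section \<open>Edge colourings\<close>

text \<open>For a bare edge set rather than a graph, because graphs are coloured here in pieces that
  are glued afterwards.\<close>

definition edge_colourable :: "'a set set \<Rightarrow> nat \<Rightarrow> bool" where
  "edge_colourable E k \<longleftrightarrow>
     (\<exists>c. (\<forall>e\<in>E. c e < k) \<and> (\<forall>e\<in>E. \<forall>f\<in>E. e \<noteq> f \<and> e \<inter> f \<noteq> {} \<longrightarrow> c e \<noteq> (c f :: nat)))"

lemma edge_colourableI:
  assumes "\<And>e. e \<in> E \<Longrightarrow> c e < k"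
    and "\<And>e f. e \<in> E \<Longrightarrow> f \<in> E \<Longrightarrow> e \<noteq> f \<Longrightarrow> e \<inter> f \<noteq> {} \<Longrightarrow> c e \<noteq> c f"
  shows "edge_colourable E k"
  unfolding edge_colourable_def using assms by (intro exI[of _ c]) simp

lemma edge_colourableE:
  assumes "edge_colourable E k"
  obtains c where "\<And>e. e \<in> E \<Longrightarrow> c e < k"
    and "\<And>e f. e \<in> E \<Longrightarrow> f \<in> E \<Longrightarrow> e \<noteq> f \<Longrightarrow> e \<inter> f \<noteq> {} \<Longrightarrow> c e \<noteq> c f"
proof -
  from assms obtain c where "\<forall>e\<in>E. c e < k"
      "\<forall>e\<in>E. \<forall>f\<in>E. e \<noteq> f \<and> e \<inter> f \<noteq> {} \<longrightarrow> c e \<noteq> c f"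
    unfolding edge_colourable_def by metis
  then show ?thesis by - (rule that[of c]; simp)
qed

lemma edge_colourable_mono: "edge_colourable F k \<Longrightarrow> E \<subseteq> F \<Longrightarrow> edge_colourable E k"
  unfolding edge_colourable_def by (meson subsetD)

lemma edge_colourable_Un:
  assumes "edge_colourable E k" "edge_colourable F l"
  shows "edge_colourable (E \<union> F) (k + l)"
proof -
  obtain c where c: "\<And>e. e \<in> E \<Longrightarrow> c e < k"
      "\<And>e f. e \<in> E \<Longrightarrow> f \<in> E \<Longrightarrow> e \<noteq> f \<Longrightarrow> e \<inter> f \<noteq> {} \<Longrightarrow> c e \<noteq> c f"
    using edge_colourableE[OF assms(1)] by metis
  obtain d where d: "\<And>e. e \<in> F \<Longrightarrow> d e < l"
      "\<And>e f. e \<in> F \<Longrightarrow> f \<in> F \<Longrightarrow> e \<noteq> f \<Longrightarrow> e \<inter> f \<noteq> {} \<Longrightarrow> d e \<noteq> d f"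
    using edge_colourableE[OF assms(2)] by metis
  let ?h = "\<lambda>e. if e \<in> E then c e else k + d e"
  have "?h e < k + l" if "e \<in> E \<union> F" for e
    using that c(1)[of e] d(1)[of e] by auto
  moreover have "?h e \<noteq> ?h f"
    if "e \<in> E \<union> F" "f \<in> E \<union> F" "e \<noteq> f" "e \<inter> f \<noteq> {}" for e f
    using that c(1)[of e] c(1)[of f] c(2)[of e f] d(2)[of e f] by auto
  ultimately show ?thesis by (rule edge_colourableI)
qed

lemma edge_colourable_UN:
  fixes q :: nat
  assumes "\<And>r. r < q \<Longrightarrow> edge_colourable (E r) (D r)"
  shows "edge_colourable (\<Union>r<q. E r) (\<Sum>r<q. D r)"
  using assms
proof (induction q)
  case 0
  show ?case by (simp add: edge_colourable_def)
next
  case (Suc q)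
  then have "edge_colourable ((\<Union>r<q. E r) \<union> E q) ((\<Sum>r<q. D r) + D q)"
    by (intro edge_colourable_Un) auto
  then show ?case by (simp add: lessThan_Suc Un_commute add.commute)
qed

text \<open>Members without a common vertex can use the same \<open>k\<close> colours; this lets all
  pairs of one round be coloured at once.\<close>

lemma edge_colourable_Union_disjoint:
  assumes col: "\<And>E. E \<in> \<E> \<Longrightarrow> edge_colourable E k"
    and disj: "\<And>E F e f. E \<in> \<E> \<Longrightarrow> F \<in> \<E> \<Longrightarrow> E \<noteq> F \<Longrightarrow> e \<in> E \<Longrightarrow> f \<in> F \<Longrightarrow> e \<inter> f = {}"
  shows "edge_colourable (\<Union>\<E>) k"
proof -
  have "\<forall>E\<in>\<E>. \<exists>c. (\<forall>e\<in>E. c e < k) \<and>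
      (\<forall>e\<in>E. \<forall>f\<in>E. e \<noteq> f \<and> e \<inter> f \<noteq> {} \<longrightarrow> c e \<noteq> (c f :: nat))"
    using col unfolding edge_colourable_def by (rule ballI)
  then obtain c where c: "\<And>E e. E \<in> \<E> \<Longrightarrow> e \<in> E \<Longrightarrow> c E e < k"
    "\<And>E e f. E \<in> \<E> \<Longrightarrow> e \<in> E \<Longrightarrow> f \<in> E \<Longrightarrow> e \<noteq> f \<Longrightarrow> e \<inter> f \<noteq> {} \<Longrightarrow> c E e \<noteq> (c E f :: nat)"
    by (metis (no_types, lifting) bchoice)
  define part where "part e = (SOME E. E \<in> \<E> \<and> e \<in> E)" for e
  have part: "part e \<in> \<E>" "e \<in> part e" if "e \<in> \<Union>\<E>" for e
    using someI_ex[of "\<lambda>E. E \<in> \<E> \<and> e \<in> E"] that unfolding part_def by auto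
  let ?h = "\<lambda>e. c (part e) e"
  have "?h e < k" if "e \<in> \<Union>\<E>" for e
    using c(1) part that by blast
  moreover have "?h e \<noteq> ?h f"
    if ef: "e \<in> \<Union>\<E>" "f \<in> \<Union>\<E>" "e \<noteq> f" "e \<inter> f \<noteq> {}" for e f
  proof -
    have "part e = part f"
      using disj[OF part(1) part(1) _ part(2) part(2)] ef by blast
    with c(2)[of "part e" e f] part ef show ?thesis by metis
  qed
  ultimately show ?thesis by (rule edge_colourableI)
qed

text \<open>The edges at a vertex have different colours, so the maximum degree bounds the chromatic
  index from below; the colouring bounds it from above by \<open>D\<close>, which is at most the
  degree of \<open>v\<close>.\<close>

lemma class_1I:
  assumes "finite (verts G)" "finite (edges G)" "v \<in> verts G"
    and deg: "D \<le> degree G v" and col: "edge_colourable (edges G) D"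
  shows "class_1 G"
proof -
  let ?P = "\<lambda>k. \<exists>c. proper_edge_colouring G c \<and> c ` edges G \<subseteq> {..<k}"
  have "degree G v \<le> max_degree G" if "v \<in> verts G" for v
    using that assms(1) by (simp add: max_degree_def)
  moreover have "?P D"
    using col by (auto simp: edge_colourable_def proper_edge_colouring_def)
  then have "chromatic_index G \<le> D"
    unfolding chromatic_index_def by (rule Least_le)
  moreover have "degree G u \<le> chromatic_index G" for u
  proof -
    have "?P (chromatic_index G)"
      unfolding chromatic_index_def using \<open>?P D\<close> by (rule LeastI)
    then obtain c where c: "proper_edge_colouring G c" "c ` edges G \<subseteq> {..<chromatic_index G}"
      by blast
    let ?S = "{e \<in> edges G. u \<in> e}"
    have "inj_on c ?S"
      using c(1) by (fastforce simp: proper_edge_colouring_def inj_on_def)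
    then have "card ?S = card (c ` ?S)" by (simp add: card_image)
    also have "\<dots> \<le> card {..<chromatic_index G}"
      using c(2) by (intro card_mono) auto
    finally show ?thesis by (simp add: degree_def)
  qed
  then have "max_degree G \<le> chromatic_index G"
    using assms(1,3) unfolding max_degree_def by (subst Max_le_iff) auto
  ultimately show ?thesis
    using deg assms(3) unfolding class_1_def by fastforce
qed

section \<open>Matchings and edge colourings of bipartite graphs\<close>

text \<open>Halmos-Vaughan induction on the size of \<open>X\<close>. If some nonempty proper
  \<open>S\<close> has exactly as many neighbours as elements, \<open>S\<close> and
  \<open>X - S\<close> are matched separately; otherwise every such set has a surplus and any single
  pair can be fixed.\<close>

theorem hall_marriage:
  fixes A :: "'a \<Rightarrow> 'b set"
  assumes "finite X" "\<And>x. x \<in> X \<Longrightarrow> finite (A x)"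
    and "\<And>S. S \<subseteq> X \<Longrightarrow> card S \<le> card (\<Union>(A ` S))"
  shows "\<exists>f. inj_on f X \<and> (\<forall>x\<in>X. f x \<in> A x)"
  using assms
proof (induction "card X" arbitrary: X A rule: less_induct)
  case less
  show ?case
  proof (cases "\<exists>S. S \<subset> X \<and> S \<noteq> {} \<and> card S = card (\<Union>(A ` S))")
    case True
    then obtain S where S: "S \<subset> X" "S \<noteq> {}" "card S = card (\<Union>(A ` S))" by blast
    have finS: "finite S" using S less.prems(1) finite_subset by auto
    have finA: "finite (\<Union>(A ` T))" if "T \<subseteq> X" for T
      using that less.prems(1,2) by (meson finite_UN_I finite_subset subsetD)
    have "card S < card X" using S(1) less.prems(1) by (simp add: psubset_card_mono)
    then have "\<exists>f. inj_on f S \<and> (\<forall>x\<in>S. f x \<in> A x)"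
    proof (rule less.hyps[OF _ finS])
      show "card T \<le> card (\<Union>(A ` T))" if "T \<subseteq> S" for T
        using that S(1) by (intro less.prems(3)) auto
      show "finite (A x)" if "x \<in> S" for x using that S(1) less.prems(2) by blast
    qed
    then obtain f where f: "inj_on f S" "\<And>x. x \<in> S \<Longrightarrow> f x \<in> A x" by blast
    let ?B = "\<lambda>x. A x - \<Union>(A ` S)"
    have "card (X - S) < card X"
      using S(1,2) less.prems(1) by (intro psubset_card_mono) auto
    \<comment> \<open>The neighbourhood of \<open>S \<union> T\<close> exceeds that of the tight set
      \<open>S\<close> by at least \<open>card T\<close>.\<close>
    moreover have "card T \<le> card (\<Union>(?B ` T))" if T: "T \<subseteq> X - S" for T
    proof -
      have finT: "finite T" using T less.prems(1) by (meson Diff_subset finite_subset)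
      have "\<Union>(A ` (S \<union> T)) = \<Union>(A ` S) \<union> \<Union>(?B ` T)" by auto
      moreover have "finite (\<Union>(?B ` T))"
        using finA[of T] T by (auto intro: finite_subset[of _ "\<Union>(A ` T)"])
      ultimately have "card (\<Union>(A ` (S \<union> T))) = card (\<Union>(A ` S)) + card (\<Union>(?B ` T))"
        using finA[of S] S(1) card_Un_disjoint[of "\<Union>(A ` S)" "\<Union>(?B ` T)"] by auto
      moreover have "card (S \<union> T) \<le> card (\<Union>(A ` (S \<union> T)))"
        using T S(1) by (intro less.prems(3)) auto
      moreover have "card (S \<union> T) = card S + card T"
        using T finS finT by (intro card_Un_disjoint) auto
      ultimately show ?thesis using S(3) by simp
    qed
    ultimately have "\<exists>g. inj_on g (X - S) \<and> (\<forall>x\<in>X - S. g x \<in> ?B x)"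
      using less.prems(1,2) by (intro less.hyps) simp_all
    then obtain g where g: "inj_on g (X - S)" "\<And>x. x \<in> X - S \<Longrightarrow> g x \<in> ?B x" by blast
    let ?h = "\<lambda>x. if x \<in> S then f x else g x"
    have "inj_on ?h X"
    proof (rule inj_onI)
      fix x y assume xy: "x \<in> X" "y \<in> X" "?h x = ?h y"
      consider "x \<in> S" "y \<in> S" | "x \<notin> S" "y \<notin> S" | "x \<in> S" "y \<notin> S" | "x \<notin> S" "y \<in> S"
        by blast
      then show "x = y"
      proof cases
        case 1 then show ?thesis using xy f(1) by (simp add: inj_on_eq_iff)
      next
        case 2 then show ?thesis using xy g(1) by (simp add: inj_on_eq_iff)
      next
        case 3 then show ?thesis using xy f(2)[of x] g(2)[of y] by auto
      next
        case 4 then show ?thesis using xy f(2)[of y] g(2)[of x] by force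
      qed
    qed
    moreover have "\<forall>x\<in>X. ?h x \<in> A x" using f(2) g(2) by auto
    ultimately show ?thesis by blast
  next
    case False
    show ?thesis
    proof (cases "X = {}")
      case False
      then obtain x where x: "x \<in> X" by blast
      have "card {x} \<le> card (\<Union>(A ` {x}))" using x by (intro less.prems(3)) auto
      then obtain y where y: "y \<in> A x" by (cases "A x = {}") auto
      let ?B = "\<lambda>z. A z - {y}"
      have "card (X - {x}) < card X" using x less.prems(1) by (rule card_Diff1_less[rotated])
      moreover have "card T \<le> card (\<Union>(?B ` T))" if T: "T \<subseteq> X - {x}" for T
      proof (cases "T = {}")
        case False
        \<comment> \<open>\<open>T\<close> omits \<open>x\<close>, so it is proper and has a surplus
          of one, which pays for the removal of \<open>y\<close>.\<close>
        have "card T \<noteq> card (\<Union>(A ` T))" "T \<subseteq> X"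
          using \<open>\<not> (\<exists>S. S \<subset> X \<and> S \<noteq> {} \<and> card S = card (\<Union>(A ` S)))\<close> T False x by blast+
        then have "card T < card (\<Union>(A ` T))"
          using less.prems(3)[of T] by linarith
        moreover have "\<Union>(?B ` T) = \<Union>(A ` T) - {y}" by auto
        ultimately show ?thesis
          by (cases "y \<in> \<Union>(A ` T)") (simp_all add: card_Diff_singleton)
      qed simp
      ultimately have "\<exists>f. inj_on f (X - {x}) \<and> (\<forall>z\<in>X - {x}. f z \<in> ?B z)"
        using less.prems(1,2) by (intro less.hyps) simp_all
      then obtain f where f: "inj_on f (X - {x})" "\<And>z. z \<in> X - {x} \<Longrightarrow> f z \<in> ?B z" by blast
      have "inj_on (f(x := y)) X" using f by (auto simp: inj_on_def)
      moreover have "\<forall>z\<in>X. (f(x := y)) z \<in> A z" using f(2) y by auto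
      ultimately show ?thesis by blast
    qed simp
  qed
qed

section \<open>Regular bipartite graphs: perfect matchings and Koenig's theorem\<close>

definition biregular :: "('a \<times> 'b) set \<Rightarrow> 'a set \<Rightarrow> 'b set \<Rightarrow> nat \<Rightarrow> bool" where
  "biregular R X Y r \<longleftrightarrow> R \<subseteq> X \<times> Y \<and> (\<forall>x\<in>X. card (R `` {x}) = r) \<and> (\<forall>y\<in>Y. card (R\<inverse> `` {y}) = r)"

lemma card_rel_rows:
  assumes "finite X" "finite Y" "R \<subseteq> X \<times> Y"
  shows "card R = (\<Sum>x\<in>X. card (R `` {x}))"
proof -
  have "R = (SIGMA x:X. R `` {x})" using assms(3) by auto
  moreover have "finite (R `` {x})" for x
    using assms by (auto intro: finite_subset[of _ Y])
  ultimately show ?thesis using assms(1) card_SigmaI by metis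
qed

text \<open>Double counting gives Hall's condition: \<open>r * card S\<close> edges leave
  \<open>S\<close>, and each neighbour absorbs at most \<open>r\<close> of them. Counting all edges
  from both sides gives \<open>card X = card Y\<close>, so the injection is onto.\<close>

lemma biregular_matching:
  assumes R: "biregular R X Y r" and fin: "finite X" "finite Y" and "r > 0"
  shows "\<exists>\<mu>. bij_betw \<mu> X Y \<and> (\<forall>x\<in>X. (x, \<mu> x) \<in> R)"
proof -
  have sub: "R \<subseteq> X \<times> Y" and row: "\<And>x. x \<in> X \<Longrightarrow> card (R `` {x}) = r"
    and col: "\<And>y. y \<in> Y \<Longrightarrow> card (R\<inverse> `` {y}) = r"
    using R by (auto simp: biregular_def)
  have cY: "card (Q\<inverse>) \<le> r * card B" if "Q \<subseteq> R" "Q \<subseteq> X \<times> B" "B \<subseteq> Y" for Q B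
  proof -
    have "card (Q\<inverse>) = (\<Sum>y\<in>B. card (Q\<inverse> `` {y}))"
      using that fin by (intro card_rel_rows[of _ X]) (auto intro: finite_subset)
    also have "\<dots> \<le> (\<Sum>y\<in>B. r)"
    proof (rule sum_mono)
      fix y assume "y \<in> B"
      then have "card (Q\<inverse> `` {y}) \<le> card (R\<inverse> `` {y})"
        using that sub fin by (intro card_mono) (auto intro: finite_subset[of _ X])
      then show "card (Q\<inverse> `` {y}) \<le> r" using col \<open>y \<in> B\<close> that by auto
    qed
    finally show ?thesis by (simp add: mult.commute)
  qed
  have hall_cond: "card S \<le> card (\<Union>((\<lambda>x. R `` {x}) ` S))" if S: "S \<subseteq> X" for S
  proof -
    let ?Q = "R \<inter> S \<times> Y"
    have "card ?Q = (\<Sum>x\<in>S. card (?Q `` {x}))"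
      using S fin by (intro card_rel_rows[of _ Y]) (auto intro: finite_subset)
    also have "\<dots> = (\<Sum>x\<in>S. r)"
    proof (rule sum.cong)
      fix x assume "x \<in> S"
      then have "?Q `` {x} = R `` {x}" using sub by auto
      then show "card (?Q `` {x}) = r" using row S \<open>x \<in> S\<close> by auto
    qed simp
    finally have "r * card S = card (?Q\<inverse>)" by (simp add: card_inverse)
    also have "\<dots> \<le> r * card (\<Union>((\<lambda>x. R `` {x}) ` S))"
      using sub S by (intro cY) auto
    finally show ?thesis using \<open>r > 0\<close> by simp
  qed
  have "finite (R `` {x})" for x
    using sub fin(2) by (auto intro: finite_subset[of _ Y])
  then obtain \<mu> where \<mu>: "inj_on \<mu> X" "\<And>x. x \<in> X \<Longrightarrow> \<mu> x \<in> R `` {x}"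
    using hall_marriage[of X "\<lambda>x. R `` {x}"] fin hall_cond by auto
  have "card (\<mu> ` X) = card Y"
  proof -
    have "r * card X = card R"
      using card_rel_rows[OF fin sub] row by simp
    also have "card R = card (R\<inverse>)" by (simp add: card_inverse)
    also have "\<dots> = r * card Y"
    proof -
      have "R\<inverse> \<subseteq> Y \<times> X" using sub by auto
      with card_rel_rows[of Y X "R\<inverse>"] fin col show ?thesis by simp
    qed
    finally show ?thesis using \<open>r > 0\<close> \<mu>(1) by (simp add: card_image)
  qed
  moreover have "\<mu> ` X \<subseteq> Y" using \<mu>(2) sub by auto
  ultimately have "\<mu> ` X = Y" using fin by (simp add: card_subset_eq)
  with \<mu> show ?thesis by (auto simp: bij_betw_def)
qed

lemma biregular_Diff_matching:
  assumes R: "biregular R X Y (Suc r)" and fin: "finite X" "finite Y"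
    and \<mu>: "bij_betw \<mu> X Y" "\<And>x. x \<in> X \<Longrightarrow> (x, \<mu> x) \<in> R"
  shows "biregular (R - (\<lambda>x. (x, \<mu> x)) ` X) X Y r"
proof -
  let ?R = "R - (\<lambda>x. (x, \<mu> x)) ` X"
  have sub: "R \<subseteq> X \<times> Y" using R by (simp add: biregular_def)
  have "card (?R `` {x}) = r" if "x \<in> X" for x
  proof -
    have "?R `` {x} = R `` {x} - {\<mu> x}" using that by auto
    then show ?thesis using that R \<mu>(2)[OF that] by (simp add: biregular_def)
  qed
  moreover have "card (?R\<inverse> `` {y}) = r" if y: "y \<in> Y" for y
  proof -
    obtain x where x: "x \<in> X" "y = \<mu> x" using \<mu>(1) y by (auto simp: bij_betw_def)
    have "?R\<inverse> `` {y} = R\<inverse> `` {y} - {x}"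
      using x \<mu>(1) sub by (auto simp: bij_betw_def inj_on_eq_iff)
    then show ?thesis using x y R \<mu>(2)[OF x(1)] by (simp add: biregular_def)
  qed
  ultimately show ?thesis using sub by (auto simp: biregular_def)
qed

definition cross :: "('a \<times> 'a) set \<Rightarrow> 'a set set" where
  "cross R = (\<lambda>(x, y). {x, y}) ` R"

lemma edge_colourable_cross_matching:
  assumes "bij_betw \<mu> X Y" "X \<inter> Y = {}"
  shows "edge_colourable (cross ((\<lambda>x. (x, \<mu> x)) ` X)) 1"
proof -
  have "e = f" if ef: "e \<in> cross ((\<lambda>x. (x, \<mu> x)) ` X)" "f \<in> cross ((\<lambda>x. (x, \<mu> x)) ` X)" "e \<inter> f \<noteq> {}" for e f
  proof -
    obtain x y where xy: "x \<in> X" "e = {x, \<mu> x}" "y \<in> X" "f = {y, \<mu> y}"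
      using ef(1,2) by (auto simp: cross_def)
    have "\<mu> x \<in> Y" "\<mu> y \<in> Y" using assms(1) xy by (auto simp: bij_betw_def)
    then have "x = y"
      using ef(3) xy assms by (auto simp: bij_betw_def inj_on_eq_iff)
    with xy show ?thesis by simp
  qed
  then show ?thesis unfolding edge_colourable_def by (intro exI[of _ "\<lambda>_. 0"]) auto
qed

text \<open>Perfect matchings are split off one at a time, each taking one colour, until the degree
  is 0.\<close>

theorem koenig:
  assumes "biregular R X Y r" "finite X" "finite Y" "X \<inter> Y = {}"
  shows "edge_colourable (cross R) r"
  using assms(1)
proof (induction r arbitrary: R)
  case 0
  have "R = {}"
  proof (rule ccontr)
    assume "R \<noteq> {}"
    then obtain x y where "(x, y) \<in> R" "x \<in> X" using 0 by (auto simp: biregular_def)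
    moreover have "finite (R `` {x})"
      using 0 assms(3) by (auto simp: biregular_def intro: finite_subset[of _ Y])
    moreover have "card (R `` {x}) = 0" using 0 \<open>x \<in> X\<close> by (simp add: biregular_def)
    ultimately show False by auto
  qed
  then show ?case by (simp add: cross_def edge_colourable_def)
next
  case (Suc r)
  obtain \<mu> where \<mu>: "bij_betw \<mu> X Y" "\<And>x. x \<in> X \<Longrightarrow> (x, \<mu> x) \<in> R"
    using biregular_matching[OF Suc.prems assms(2,3)] by auto
  let ?M = "(\<lambda>x. (x, \<mu> x)) ` X"
  have "edge_colourable (cross (R - ?M)) r"
    using biregular_Diff_matching[OF Suc.prems assms(2,3) \<mu>] by (rule Suc.IH)
  then have "edge_colourable (cross (R - ?M) \<union> cross ?M) (r + 1)"
    using edge_colourable_cross_matching[OF \<mu>(1) assms(4)] by (rule edge_colourable_Un)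
  moreover have "cross R \<subseteq> cross (R - ?M) \<union> cross ?M" by (auto simp: cross_def)
  ultimately show ?case using edge_colourable_mono by fastforce
qed

section \<open>Two odd cycles joined by a bipartite graph\<close>

text \<open>Indexing edges by position makes \<open>cycle_edge N f\<close> a cyclic sequence in its
  own right, so the construction can be iterated: \<open>cycle_edges N (cycle_edge N f)\<close>
  joins consecutive edges of the cycle \<open>f\<close>.\<close>

definition cycle_edge :: "nat \<Rightarrow> (nat \<Rightarrow> 'a) \<Rightarrow> nat \<Rightarrow> 'a set" where
  "cycle_edge N f t = {f t, f (Suc t mod N)}"

definition cycle_edges :: "nat \<Rightarrow> (nat \<Rightarrow> 'a) \<Rightarrow> 'a set set" where
  "cycle_edges N f = cycle_edge N f ` {..<N}"

lemma bij_betw_rotate: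
  fixes N :: nat
  assumes "N > 0"
  shows "bij_betw (\<lambda>t. (t + a) mod N) {..<N} {..<N}"
proof -
  have "{..<N} \<subseteq> (\<lambda>t. (t + a) mod N) ` {..<N}"
  proof
    fix s assume s: "s \<in> {..<N}"
    \<comment> \<open>\<open>N * a - a\<close> undoes the shift by \<open>a\<close> modulo
      \<open>N\<close> within the natural numbers.\<close>
    have "N * a - a + a = N * a" using assms by (cases N) auto
    then have "((s + (N * a - a)) mod N + a) mod N = (s + N * a) mod N"
      by (metis add.assoc mod_add_left_eq)
    also have "\<dots> = s" using s by simp
    finally show "s \<in> (\<lambda>t. (t + a) mod N) ` {..<N}"
      using assms by (intro image_eqI[of _ _ "(s + (N * a - a)) mod N"]) auto
  qed
  then have "(\<lambda>t. (t + a) mod N) ` {..<N} = {..<N}" using assms by auto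
  then show ?thesis by (simp add: bij_betw_def eq_card_imp_inj_on)
qed

lemma cyc_rotate:
  assumes "N > 0"
  shows "cycle_edges N (\<lambda>t. f ((t + a) mod N)) = cycle_edges N f"
proof -
  have "Suc ((t + a) mod N) mod N = (Suc t mod N + a) mod N" for t
    by (simp add: mod_Suc_eq mod_add_left_eq)
  then have "cycle_edges N (\<lambda>t. f ((t + a) mod N)) =
      cycle_edge N f ` (\<lambda>t. (t + a) mod N) ` {..<N}"
    by (simp add: cycle_edges_def cycle_edge_def image_image)
  then show ?thesis
    using bij_betw_rotate[OF assms, of a] by (simp add: cycle_edges_def bij_betw_def)
qed

lemma edge_colourable_matching:
  assumes "\<And>e f. e \<in> E \<Longrightarrow> f \<in> E \<Longrightarrow> e \<inter> f \<noteq> {} \<Longrightarrow> e = f"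
  shows "edge_colourable E 1"
  by (rule edge_colourableI[where c = "\<lambda>_. 0"]) (use assms in auto)

text \<open>Both cycles are coloured alternately 0 and 1 up to their last edge, which gets colour 2. The matching
  edges are coloured 2, except that those at the ends of the two last edges get the colour missing there.\<close>

lemma edge_colourable_two_cycles_aux:
  assumes odd: "odd N" "N \<ge> 3"
    and f: "bij_betw f {..<N} X" and g: "bij_betw g {..<N} Y" and disj: "X \<inter> Y = {}"
    and \<mu>: "bij_betw \<mu> X Y" "\<mu> (f 0) = g 0" "\<mu> (f (N - 1)) = g (N - 1)"
  shows "edge_colourable (cross ((\<lambda>x. (x, \<mu> x)) ` X) \<union> cycle_edges N f \<union> cycle_edges N g) 3"
proof -
  obtain n where n: "N = Suc (2 * n)" "n \<ge> 1"
  proof -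
    from odd(1) obtain n where "N = 2 * n + 1" by (rule oddE)
    with odd(2) that[of n] show thesis by simp
  qed
  have ff: "f s = f t \<longleftrightarrow> s = t" if "s < N" "t < N" for s t
    using f that by (auto simp: bij_betw_def inj_on_eq_iff)
  have gg: "g s = g t \<longleftrightarrow> s = t" if "s < N" "t < N" for s t
    using g that by (auto simp: bij_betw_def inj_on_eq_iff)
  have fX: "f t \<in> X" and gY: "g t \<in> Y" if "t < N" for t
    using f g that by (auto simp: bij_betw_def)
  have fg: "f s \<noteq> g t" "g t \<noteq> f s" if "s < N" "t < N" for s t
    using fX[OF that(1)] gY[OF that(2)] disj by auto
  \<comment> \<open>\<open>h\<close> lists \<open>Y\<close> in the order transported from the first
    cycle; it agrees with \<open>g\<close> at both ends of the closing edge.\<close>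
  define h where "h t = \<mu> (f t)" for t
  have hY: "h t \<in> Y" if "t < N" for t
    using \<mu>(1) fX[OF that] by (auto simp: bij_betw_def h_def)
  have hh: "h s = h t \<longleftrightarrow> s = t" if "s < N" "t < N" for s t
    using \<mu>(1) fX that ff by (auto simp: bij_betw_def inj_on_eq_iff h_def)
  have fh: "f s \<noteq> h t" "h t \<noteq> f s" if "s < N" "t < N" for s t
    using fX[OF that(1)] hY[OF that(2)] disj by auto
  have h0: "g 0 = h 0" and h1: "g (2 * n) = h (2 * n)"
    using \<mu>(2,3) by (simp_all add: h_def n)
  \<comment> \<open>The three colour classes. Alternate edges from position 0 miss only position
    \<open>2 * n\<close>, those from position 1 miss only position 0, and the matching edges at
    these two positions fill the gaps. In \<open>?E2\<close> the second closing edge is written with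
    \<open>h\<close>, so that one indexing shows that it avoids the matching edges.\<close>
  let ?E0 = "(\<lambda>s. {f (2 * s), f (Suc (2 * s))}) ` {..<n} \<union> (\<lambda>s. {g (2 * s), g (Suc (2 * s))}) ` {..<n}
    \<union> {{f (2 * n), g (2 * n)}}"
  let ?E1 = "(\<lambda>s. {f (Suc (2 * s)), f (Suc (Suc (2 * s)))}) ` {..<n}
    \<union> (\<lambda>s. {g (Suc (2 * s)), g (Suc (Suc (2 * s)))}) ` {..<n} \<union> {{f 0, g 0}}"
  let ?E2 = "(\<lambda>t. {f t, h t}) ` {0<..<2 * n} \<union> {{f (2 * n), f 0}} \<union> {{h (2 * n), h 0}}"
  have "edge_colourable ?E0 1"
    by (rule edge_colourable_matching) (auto simp: n ff gg fg, presburger+)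
  moreover have "edge_colourable ?E1 1"
    by (rule edge_colourable_matching) (auto simp: n ff gg fg, presburger+)
  moreover have "edge_colourable ?E2 1"
    by (rule edge_colourable_matching) (auto simp: n ff hh fh)
  ultimately have "edge_colourable (?E0 \<union> ?E1 \<union> ?E2) (1 + 1 + 1)"
    by (intro edge_colourable_Un)
  moreover have "cross ((\<lambda>x. (x, \<mu> x)) ` X) \<subseteq> ?E0 \<union> ?E1 \<union> ?E2"
  proof
    fix e assume "e \<in> cross ((\<lambda>x. (x, \<mu> x)) ` X)"
    then obtain x where "x \<in> X" "e = {x, \<mu> x}" by (auto simp: cross_def)
    then obtain t where t: "t < N" "e = {f t, h t}"
      using f by (auto simp: bij_betw_def h_def)
    consider "t = 0" | "t = 2 * n" | "t \<in> {0<..<2 * n}" using t(1) n by fastforce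
    then show "e \<in> ?E0 \<union> ?E1 \<union> ?E2" by cases (use t(2) h0 h1 in auto)
  qed
  moreover have cycle_edges: "cycle_edges N k \<subseteq> (\<lambda>s. {k (2 * s), k (Suc (2 * s))}) ` {..<n} \<union>
      (\<lambda>s. {k (Suc (2 * s)), k (Suc (Suc (2 * s)))}) ` {..<n} \<union> {{k (2 * n), k 0}}"
    (is "_ \<subseteq> ?F k") for k :: "nat \<Rightarrow> 'a"
  proof
    fix e assume "e \<in> cycle_edges N k"
    then obtain t where t: "t < N" "e = {k t, k (Suc t mod N)}" by (auto simp: cycle_edges_def cycle_edge_def)
    consider "t = 2 * n" | s where "t = 2 * s" "s < n" | s where "t = Suc (2 * s)" "s < n"
      using t(1) n by (cases "even t") (auto elim!: evenE oddE simp: less_Suc_eq_le le_less)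
    then show "e \<in> ?F k" by cases (use t n in auto)
  qed
  have "cycle_edges N f \<subseteq> ?E0 \<union> ?E1 \<union> ?E2" "cycle_edges N g \<subseteq> ?E0 \<union> ?E1 \<union> ?E2"
    using cycle_edges[of f] cycle_edges[of g] h0 h1 by auto
  ultimately show ?thesis
    using edge_colourable_mono[of "?E0 \<union> ?E1 \<union> ?E2" 3 "cross ((\<lambda>x. (x, \<mu> x)) ` X) \<union> cycle_edges N f \<union> cycle_edges N g"]
    by (simp add: numeral_3_eq_3)
qed

text \<open>Rotation makes the two edges matched by \<open>\<mu>\<close> the closing edges of their
  cycles. The matching and both cycles take 3 colours, and the remaining
  \<open>(r - 1)\<close>-regular graph takes \<open>r - 1\<close> by Koenig's theorem.\<close>

lemma edge_colourable_two_cycles: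
  assumes odd: "odd N" "N \<ge> 3"
    and f: "bij_betw f {..<N} X" and g: "bij_betw g {..<N} Y" and disj: "X \<inter> Y = {}"
    and R: "biregular R X Y r"
    and \<mu>: "bij_betw \<mu> X Y" "\<And>x. x \<in> X \<Longrightarrow> (x, \<mu> x) \<in> R"
    and t: "t < N" "u < N" "\<mu> (f t) = g u" "\<mu> (f (Suc t mod N)) = g (Suc u mod N)"
  shows "edge_colourable (cross R \<union> cycle_edges N f \<union> cycle_edges N g) (r + 2)"
proof -
  have fin: "finite X" "finite Y" using f g bij_betw_finite by blast+
  have x: "f t \<in> X" (is "?x \<in> X") using f t(1) by (auto simp: bij_betw_def)
  have "R `` {?x} \<noteq> {}" "finite (R `` {?x})" "card (R `` {?x}) = r"
    using \<mu>(2)[OF x] R x fin(2) by (auto simp: biregular_def intro: finite_subset[of _ Y])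
  then obtain r' where r: "r = Suc r'" by (cases r) auto
  let ?M = "(\<lambda>x. (x, \<mu> x)) ` X"
  let ?f = "\<lambda>s. f ((s + Suc t) mod N)" and ?g = "\<lambda>s. g ((s + Suc u) mod N)"
  have pos: "N > 0" using odd(2) by simp
  have "bij_betw ?f {..<N} X" "bij_betw ?g {..<N} Y"
    using bij_betw_trans[OF bij_betw_rotate[OF pos, of "Suc t"] f]
      bij_betw_trans[OF bij_betw_rotate[OF pos, of "Suc u"] g]
    unfolding comp_def .
  moreover have "(N - 1 + Suc t) mod N = t" "(N - 1 + Suc u) mod N = u"
    using t pos by simp_all
  ultimately have "edge_colourable (cross ?M \<union> cycle_edges N ?f \<union> cycle_edges N ?g) 3"
    using t disj \<mu>(1) by (intro edge_colourable_two_cycles_aux[where X = X and Y = Y] odd) simp_all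
  moreover have "edge_colourable (cross (R - ?M)) r'"
    using biregular_Diff_matching[OF R[unfolded r] fin \<mu>] fin disj by (rule koenig)
  ultimately have three_r: "edge_colourable (cross ?M \<union> cycle_edges N ?f \<union> cycle_edges N ?g \<union> cross (R - ?M)) (3 + r')"
    by (rule edge_colourable_Un)
  have sub: "cross R \<subseteq> cross ?M \<union> cross (R - ?M)" by (auto simp: cross_def)
  have "A \<union> F \<union> G \<subseteq> B \<union> F \<union> G \<union> C" if "A \<subseteq> B \<union> C" for A B C F G :: "'a set set"
    using that by blast
  from this[OF sub] have "cross R \<union> cycle_edges N f \<union> cycle_edges N g \<subseteq> cross ?M \<union> cycle_edges N ?f \<union> cycle_edges N ?g \<union> cross (R - ?M)"
    by (simp only: cyc_rotate[OF pos, of f "Suc t"] cyc_rotate[OF pos, of g "Suc u"])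
  with three_r have "edge_colourable (cross R \<union> cycle_edges N f \<union> cycle_edges N g) (3 + r')"
    by (rule edge_colourable_mono)
  then show ?thesis by (simp add: r numeral_3_eq_3)
qed

text \<open>The surplus 2 keeps Hall's condition valid after two prescribed edges of the matching, with their
  four ends, have been removed.\<close>

definition expanding :: "('a \<times> 'b) set \<Rightarrow> 'a set \<Rightarrow> 'b set \<Rightarrow> bool" where
  "expanding R X Y \<longleftrightarrow>
     R \<subseteq> X \<times> Y \<and> (\<forall>S\<subseteq>X. S \<noteq> {} \<longrightarrow> R `` S = Y \<or> card S + 2 \<le> card (R `` S))"

text \<open>Hall's theorem for the points other than \<open>x\<close> and \<open>x'\<close>:
  removing \<open>y\<close> and \<open>y'\<close> costs a neighbourhood at most 2, which the surplus
  covers; a neighbourhood that is all of \<open>Y\<close> keeps \<open>card Y - 2\<close> elements,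
  as many as there are points left.\<close>

lemma expanding_matching:
  assumes R: "expanding R X Y" and fin: "finite X" "finite Y" and card: "card X = card Y"
    and xy: "(x, y) \<in> R" "(x', y') \<in> R" "x \<noteq> x'" "y \<noteq> y'"
  shows "\<exists>\<mu>. bij_betw \<mu> X Y \<and> (\<forall>z\<in>X. (z, \<mu> z) \<in> R) \<and> \<mu> x = y \<and> \<mu> x' = y'"
proof -
  have sub: "R \<subseteq> X \<times> Y" using R by (simp add: expanding_def)
  let ?X = "X - {x, x'}" and ?A = "\<lambda>z. R `` {z} - {y, y'}"
  have "\<exists>\<nu>. inj_on \<nu> ?X \<and> (\<forall>z\<in>?X. \<nu> z \<in> ?A z)"
  proof (rule hall_marriage)
    show "finite (?A z)" for z
      using sub fin by (auto intro: finite_subset[of _ Y])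
    fix S assume S: "S \<subseteq> ?X"
    show "card S \<le> card (\<Union>(?A ` S))"
    proof (cases "S = {}")
      case False
      have eq: "\<Union>(?A ` S) = R `` S - {y, y'}" by auto
      have finS: "finite (R `` S)" using sub fin by (auto intro: finite_subset[of _ Y])
      have ge: "card (R `` S) - 2 \<le> card (R `` S - {y, y'})"
        using diff_card_le_card_Diff[of "{y, y'}" "R `` S"] xy(4) by simp
      from R S False consider "R `` S = Y" | "card S + 2 \<le> card (R `` S)"
        unfolding expanding_def by blast
      then show ?thesis
      proof cases
        case 1
        have "card S \<le> card ?X" using S fin by (intro card_mono) auto
        also have "\<dots> = card Y - 2"
          using xy sub fin card by (subst card_Diff_subset) auto
        finally show ?thesis using ge 1 eq by simp
      next
        case 2
        then show ?thesis using ge eq by simp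
      qed
    qed simp
  qed (use fin in simp)
  then obtain \<nu> where \<nu>: "inj_on \<nu> ?X" "\<And>z. z \<in> ?X \<Longrightarrow> \<nu> z \<in> ?A z" by blast
  let ?\<mu> = "\<nu>(x := y, x' := y')"
  have "inj_on ?\<mu> X"
  proof (rule inj_onI)
    fix a b assume ab: "a \<in> X" "b \<in> X" "?\<mu> a = ?\<mu> b"
    have "\<nu> z \<noteq> y" "\<nu> z \<noteq> y'" if "z \<in> ?X" for z using \<nu>(2)[OF that] by simp_all
    then show "a = b"
      using ab inj_onD[OF \<nu>(1), of a b] xy(3,4)
      by (simp add: fun_upd_apply split: if_splits) metis+
  qed
  moreover have in_R: "\<forall>z\<in>X. (z, ?\<mu> z) \<in> R" using \<nu>(2) xy by auto
  moreover have "?\<mu> ` X = Y"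
  proof (rule card_subset_eq[OF fin(2)])
    show "?\<mu> ` X \<subseteq> Y" using in_R sub by auto
    show "card (?\<mu> ` X) = card Y" using card_image[OF \<open>inj_on ?\<mu> X\<close>] card by (rule trans)
  qed
  ultimately show ?thesis using xy(3) by (intro exI[of _ ?\<mu>]) (simp add: bij_betw_def)
qed

lemma edge_colourable_two_cycles_expanding:
  assumes odd: "odd N" "N \<ge> 3"
    and f: "bij_betw f {..<N} X" and g: "bij_betw g {..<N} Y" and disj: "X \<inter> Y = {}"
    and R: "biregular R X Y r" "expanding R X Y"
    and t: "t < N" "u < N" "(f t, g u) \<in> R" "(f (Suc t mod N), g (Suc u mod N)) \<in> R"
  shows "edge_colourable (cross R \<union> cycle_edges N f \<union> cycle_edges N g) (r + 2)"
proof -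
  have fin: "finite X" "finite Y" using f g bij_betw_finite by blast+
  have card: "card X = card Y" using bij_betw_same_card[OF f] bij_betw_same_card[OF g] by simp
  have step: "s \<noteq> Suc s mod N" if "s < N" for s
    using that odd(2) by (cases "Suc s < N") (auto simp: not_less_eq less_Suc_eq_le mod_Suc)
  have "f t \<noteq> f (Suc t mod N)" "g u \<noteq> g (Suc u mod N)"
    using f g t(1,2) step odd(2) by (auto simp: bij_betw_def inj_on_eq_iff)
  from expanding_matching[OF R(2) fin card t(3,4) this]
  obtain \<mu> where "bij_betw \<mu> X Y" "\<And>z. z \<in> X \<Longrightarrow> (z, \<mu> z) \<in> R"
      "\<mu> (f t) = g u" "\<mu> (f (Suc t mod N)) = g (Suc u mod N)" by blast
  then show ?thesis
    using edge_colourable_two_cycles[OF odd f g disj R(1)] t by blast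
qed

section \<open>Hamiltonian cycles as blocks of the triangular graph\<close>

lemma Suc_mod_eq: "t < N \<Longrightarrow> Suc t mod N = (if Suc t = N then 0 else Suc t)"
  by auto

text \<open>A cycle is connected: repeated steps from any position reach all of them. The two
  expansion bounds for a cycle rest on this.\<close>

lemma Suc_closed_eq:
  assumes "A \<subseteq> {..<N}" "A \<noteq> {}" and closed: "\<And>t. t \<in> A \<Longrightarrow> Suc t mod N \<in> A"
  shows "A = {..<N}"
proof
  obtain a where a: "a \<in> A" using assms(2) by blast
  have steps: "(a + k) mod N \<in> A" for k
  proof (induction k)
    case 0
    show ?case using a assms(1) by auto
  next
    case (Suc k)
    then show ?case using closed[OF Suc.IH] by (simp add: mod_Suc_eq)
  qed
  show "{..<N} \<subseteq> A"
  proof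
    fix s assume "s \<in> {..<N}"
    then have "(a + (N - a + s)) mod N = s" using a assms(1) by auto
    then show "s \<in> A" using steps[of "N - a + s"] by simp
  qed
qed (fact assms(1))

context
  fixes N :: nat and v :: "nat \<Rightarrow> 'a" and P :: "'a set"
  assumes N: "N \<ge> 3" and v: "bij_betw v {..<N} P"
begin

lemma v_eq: "s < N \<Longrightarrow> t < N \<Longrightarrow> v s = v t \<longleftrightarrow> s = t"
  using v by (auto simp: bij_betw_def inj_on_eq_iff)

lemma edge_eq_iff: "s < N \<Longrightarrow> t < N \<Longrightarrow> cycle_edge N v s = cycle_edge N v t \<longleftrightarrow> s = t"
  using N by (auto simp: cycle_edge_def doubleton_eq_iff v_eq Suc_mod_eq split: if_splits)

lemma bij_edge: "bij_betw (cycle_edge N v) {..<N} (cycle_edges N v)"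
  by (auto simp: bij_betw_def inj_on_def edge_eq_iff cycle_edges_def)

lemma card_edge: "t < N \<Longrightarrow> card (cycle_edge N v t) = 2"
  using N by (auto simp: cycle_edge_def v_eq Suc_mod_eq card_2_iff)

lemma cyc_subset: "h \<in> cycle_edges N v \<Longrightarrow> h \<subseteq> P"
  using v by (auto simp: cycle_edges_def cycle_edge_def bij_betw_def)

lemma card_cyc_incident:
  assumes "p \<in> P"
  shows "card {h \<in> cycle_edges N v. p \<in> h} = 2"
proof -
  obtain a where a: "a < N" "p = v a" using v assms by (auto simp: bij_betw_def)
  define b where "b = (if a = 0 then N - 1 else a - 1)"
  have b: "b < N" "b \<noteq> a" using a N by (auto simp: b_def)
  have "{h \<in> cycle_edges N v. p \<in> h} = {cycle_edge N v a, cycle_edge N v b}"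
    using a b N by (auto simp: cycle_edges_def cycle_edge_def v_eq Suc_mod_eq b_def split: if_splits)
  then show ?thesis using a b by (simp add: edge_eq_iff)
qed

text \<open>In terms of positions, \<open>S\<close> covers \<open>A\<close> together with its
  successors. If this adds nothing, \<open>A\<close> is closed under successor and hence is
  everything.\<close>

lemma card_Union_edges:
  assumes "S \<subseteq> cycle_edges N v" "S \<noteq> {}"
  shows "\<Union>S = P \<or> card S + 1 \<le> card (\<Union>S)"
proof -
  let ?s = "\<lambda>t. Suc t mod N"
  define A where "A = {t. t < N \<and> cycle_edge N v t \<in> S}"
  have A: "A \<subseteq> {..<N}" "S = cycle_edge N v ` A" "A \<noteq> {}"
    using assms by (auto simp: A_def cycle_edges_def)
  have s: "?s ` A \<subseteq> {..<N}" using N by auto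
  have "card S = card A"
    using A(1,2) bij_edge by (auto simp: card_image bij_betw_def inj_on_subset)
  moreover have US: "\<Union>S = v ` (A \<union> ?s ` A)" by (auto simp: A(2) cycle_edge_def)
  moreover have "card (v ` (A \<union> ?s ` A)) = card (A \<union> ?s ` A)"
    using v A(1) s by (intro card_image) (auto simp: bij_betw_def intro: inj_on_subset)
  moreover have "A \<union> ?s ` A = {..<N}" if "card (A \<union> ?s ` A) \<le> card A"
  proof -
    have "A = A \<union> ?s ` A"
      using that A(1) by (intro card_seteq) (auto intro: finite_subset)
    then have "A = {..<N}" using A(1,3) by (intro Suc_closed_eq) auto
    then show ?thesis using s by auto
  qed
  moreover have "v ` {..<N} = P" using v by (simp add: bij_betw_def)
  ultimately show ?thesis by (metis Suc_eq_plus1 not_less_eq_eq)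
qed

text \<open>The dual count: points at positions \<open>A\<close> touch the edges at \<open>A\<close>
  and at the predecessors \<open>B\<close> of \<open>A\<close>.\<close>

lemma card_edges_touching:
  assumes "Q \<subseteq> P" "Q \<noteq> {}"
  shows "{h \<in> cycle_edges N v. Q \<inter> h \<noteq> {}} = cycle_edges N v \<or> card Q + 1 \<le> card {h \<in> cycle_edges N v. Q \<inter> h \<noteq> {}}"
proof -
  define A where "A = {t. t < N \<and> v t \<in> Q}"
  define B where "B = {t. t < N \<and> Suc t mod N \<in> A}"
  have A: "A \<subseteq> {..<N}" "Q = v ` A" "A \<noteq> {}"
    using assms v by (auto simp: A_def bij_betw_def)
  have cQ: "card Q = card A"
    using A(1,2) v by (auto simp: card_image bij_betw_def inj_on_subset)
  have "Suc t mod N < N" for t using N by simp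
  then have H: "{h \<in> cycle_edges N v. Q \<inter> h \<noteq> {}} = cycle_edge N v ` (A \<union> B)"
    by (auto simp: A_def B_def cycle_edges_def cycle_edge_def)
  have cH: "card (cycle_edge N v ` (A \<union> B)) = card (A \<union> B)"
    using bij_edge by (intro card_image) (auto simp: A_def B_def bij_betw_def intro: inj_on_subset)
  have "A \<union> B = {..<N}" if "card (A \<union> B) \<le> card A"
  proof -
    have "A = A \<union> B"
      using that by (intro card_seteq) (auto simp: A_def B_def)
    then have BA: "B \<subseteq> A" by auto
    \<comment> \<open>With \<open>B\<close> inside \<open>A\<close>, no position outside
      \<open>A\<close> has its successor in \<open>A\<close>, so the complement of \<open>A\<close>
      is closed under successor; not being the whole cycle, it is empty.\<close>
    have "{..<N} - A = {}"
    proof (rule ccontr)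
      assume "{..<N} - A \<noteq> {}"
      then have "{..<N} - A = {..<N}"
        using BA N by (intro Suc_closed_eq) (auto simp: B_def)
      then show False using A by auto
    qed
    then show ?thesis using A(1) BA by auto
  qed
  then show ?thesis
    using H cH cQ by (metis Suc_eq_plus1 cycle_edges_def not_less_eq_eq)
qed

lemma meeting_edges_in_cyc:
  assumes "s < N" "t < N" "s \<noteq> t" "cycle_edge N v s \<inter> cycle_edge N v t \<noteq> {}"
  shows "{cycle_edge N v s, cycle_edge N v t} \<in> cycle_edges N (cycle_edge N v)"
proof -
  have "Suc s mod N < N" "Suc t mod N < N" using N by simp_all
  then have "s = Suc t mod N \<or> t = Suc s mod N"
    using assms by (auto simp: cycle_edge_def v_eq Suc_mod_eq split: if_splits)
  then show ?thesis
    using assms(1,2) by (auto simp: cycle_edges_def cycle_edge_def[of N "cycle_edge N v"] insert_commute)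
qed

text \<open>Each of the two points lies on two edges of the cycle, and an edge through both would be
  \<open>{p, q}\<close> itself.\<close>

lemma card_meeting_point_pair:
  assumes "p \<in> P" "q \<in> P" "p \<noteq> q" "{p, q} \<notin> cycle_edges N v"
  shows "card {h \<in> cycle_edges N v. {p, q} \<inter> h \<noteq> {}} = 4"
proof -
  let ?I = "\<lambda>p. {h \<in> cycle_edges N v. p \<in> h}"
  have "?I p \<inter> ?I q = {}"
  proof (rule ccontr)
    assume "?I p \<inter> ?I q \<noteq> {}"
    then obtain t where t: "t < N" "{p, q} \<subseteq> cycle_edge N v t" by (auto simp: cycle_edges_def)
    then have "{p, q} = cycle_edge N v t"
      using card_edge[OF t(1)] assms(3)
      by (intro card_subset_eq) (auto simp: cycle_edge_def)
    then show False using assms(4) t(1) by (auto simp: cycle_edges_def)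
  qed
  moreover have "{h \<in> cycle_edges N v. {p, q} \<inter> h \<noteq> {}} = ?I p \<union> ?I q" by auto
  moreover have "finite (?I p)" "finite (?I q)" by (auto simp: cycle_edges_def)
  ultimately show ?thesis
    using card_cyc_incident assms(1,2) by (simp add: card_Un_disjoint)
qed

end

section \<open>Bipartite graphs of meeting and of disjoint edges between two cycles\<close>

definition meet :: "'a set set \<Rightarrow> 'a set set \<Rightarrow> ('a set \<times> 'a set) set" where
  "meet X Y = {(x, y). x \<in> X \<and> y \<in> Y \<and> x \<inter> y \<noteq> {}}"

definition apart :: "'a set set \<Rightarrow> 'a set set \<Rightarrow> ('a set \<times> 'a set) set" where
  "apart X Y = {(x, y). x \<in> X \<and> y \<in> Y \<and> x \<inter> y = {}}"

lemma meet_row: "x \<in> X \<Longrightarrow> meet X Y `` {x} = {y \<in> Y. x \<inter> y \<noteq> {}}"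
  by (auto simp: meet_def)

lemma meet_converse: "(meet X Y)\<inverse> = meet Y X"
  by (auto simp: meet_def)

lemma apart_row: "x \<in> X \<Longrightarrow> apart X Y `` {x} = Y - meet X Y `` {x}"
  by (auto simp: meet_def apart_def)

lemma apart_converse: "(apart X Y)\<inverse> = apart Y X"
  by (auto simp: apart_def)

lemma biregular_apart:
  assumes "biregular (meet X Y) X Y r" "finite X" "finite Y" "card X = N" "card Y = N"
  shows "biregular (apart X Y) X Y (N - r)"
proof -
  have row: "card (apart X Y `` {x}) = N - r"
    if "x \<in> X" "card (meet X Y `` {x}) = r" "finite Y" "card Y = N" for x X Y
  proof -
    have "meet X Y `` {x} \<subseteq> Y" by (auto simp: meet_def)
    then show ?thesis
      using that by (simp add: apart_row card_Diff_subset finite_subset)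
  qed
  have "card (apart X Y `` {x}) = N - r" if "x \<in> X" for x
    using assms that by (intro row) (simp_all add: biregular_def)
  moreover have "card ((apart X Y)\<inverse> `` {y}) = N - r" if "y \<in> Y" for y
    using assms that unfolding apart_converse by (intro row) (simp_all add: biregular_def meet_converse)
  ultimately show ?thesis by (auto simp: biregular_def apart_def)
qed

context
  fixes N :: nat and v v' :: "nat \<Rightarrow> 'a" and P :: "'a set"
  assumes N: "odd N" "N \<ge> 3"
    and v: "bij_betw v {..<N} P" and v': "bij_betw v' {..<N} P"
    and disj: "cycle_edges N v \<inter> cycle_edges N v' = {}"
begin

text \<open>Takes its own pair of cycles, so that rows and columns of the meeting graph are both
  obtained by swapping them.\<close>

lemma card_row_meet:
  assumes "bij_betw u {..<N} P" "bij_betw u' {..<N} P" "cycle_edges N u \<inter> cycle_edges N u' = {}" "x \<in> cycle_edges N u"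
  shows "card (meet (cycle_edges N u) (cycle_edges N u') `` {x}) = 4"
proof -
  obtain t where t: "t < N" "x = cycle_edge N u t" using assms(4) by (auto simp: cycle_edges_def)
  obtain p q where pq: "x = {p, q}" "p \<noteq> q"
    using card_edge[OF N(2) assms(1) t(1)] t(2) by (auto simp: card_2_iff)
  show ?thesis
    using card_meeting_point_pair[OF N(2) assms(2), of p q] cyc_subset[OF N(2) assms(1,4)] assms pq
    by (auto simp: meet_row)
qed

lemma biregular_meet: "biregular (meet (cycle_edges N v) (cycle_edges N v')) (cycle_edges N v) (cycle_edges N v') 4"
  using card_row_meet[OF v v' disj] card_row_meet[OF v' v] disj
  by (auto simp: biregular_def meet_converse Int_commute) (auto simp: meet_def)

text \<open>The surplus 2 is gained in two steps: \<open>S\<close> covers at least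
  \<open>card S + 1\<close> points, and these touch at least one more edge of the other cycle than
  there are points, unless everything is already reached.\<close>

lemma expanding_meet: "expanding (meet (cycle_edges N v) (cycle_edges N v')) (cycle_edges N v) (cycle_edges N v')"
  unfolding expanding_def
proof (intro conjI allI impI)
  fix S assume S: "S \<subseteq> cycle_edges N v" "S \<noteq> {}"
  let ?R = "meet (cycle_edges N v) (cycle_edges N v')"
  have img: "?R `` S = {h \<in> cycle_edges N v'. \<Union>S \<inter> h \<noteq> {}}" using S(1) by (fastforce simp: meet_def)
  have US: "\<Union>S \<subseteq> P" using S(1) cyc_subset[OF N(2) v] by blast
  have "\<Union>S \<noteq> {}" using S by (fastforce simp: cycle_edges_def cycle_edge_def)
  note touch = card_edges_touching[OF N(2) v' US this]
  consider "\<Union>S = P" | "card S + 1 \<le> card (\<Union>S)"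
    using card_Union_edges[OF N(2) v S] by blast
  then show "?R `` S = cycle_edges N v' \<or> card S + 2 \<le> card (?R `` S)"
  proof cases
    case 1
    have "h \<inter> P \<noteq> {}" if "h \<in> cycle_edges N v'" for h
      using that cyc_subset[OF N(2) v' that] by (auto simp: cycle_edges_def cycle_edge_def)
    then show ?thesis using img 1 by auto
  next
    case 2
    then show ?thesis using touch unfolding img by auto
  qed
qed (auto simp: meet_def)

lemma card_cyc: "card (cycle_edges N v) = N" "card (cycle_edges N v') = N"
  using bij_betw_same_card[OF bij_edge[OF N(2) v]] bij_betw_same_card[OF bij_edge[OF N(2) v']] by simp_all

lemma finite_cyc: "finite (cycle_edges N f)" by (simp add: cycle_edges_def)

lemma biregular_apart_cyc: "biregular (apart (cycle_edges N v) (cycle_edges N v')) (cycle_edges N v) (cycle_edges N v') (N - 4)"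
  using biregular_meet finite_cyc finite_cyc card_cyc by (rule biregular_apart)

end

text \<open>Let \<open>?Z\<close>, the edges missed by \<open>S\<close>, be nonempty. It is
  completely joined to \<open>S\<close> in the 4-regular meeting graph, so both have at most 4
  elements. Sizes 4 and 4 would make them a component of that graph, which its expansion excludes.
  Hence the sizes add up to at most 7, and \<open>N \<ge> 9\<close> gives the surplus.\<close>

lemma expanding_apart:
  assumes N: "odd N" "N \<ge> 9"
    and v: "bij_betw v {..<N} P" and v': "bij_betw v' {..<N} P"
    and disj: "cycle_edges N v \<inter> cycle_edges N v' = {}"
  shows "expanding (apart (cycle_edges N v) (cycle_edges N v')) (cycle_edges N v) (cycle_edges N v')"
  unfolding expanding_def
proof (intro conjI allI impI)
  let ?X = "cycle_edges N v" and ?Y = "cycle_edges N v'"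
  have N3: "N \<ge> 3" using N(2) by simp
  have fin: "finite ?X" "finite ?Y" by (simp_all add: cycle_edges_def)
  fix S assume S: "S \<subseteq> ?X" "S \<noteq> {}"
  let ?Z = "?Y - apart ?X ?Y `` S"
  have reg: "biregular (meet ?X ?Y) ?X ?Y 4" by (rule biregular_meet[OF N(1) N3 v v' disj])
  have ZS: "?Z \<subseteq> meet ?X ?Y `` {x}" if "x \<in> S" for x using that S(1) by (auto simp: meet_def apart_def)
  have SZ: "S \<subseteq> (meet ?X ?Y)\<inverse> `` {z}" if "z \<in> ?Z" for z
    using that S(1) by (auto simp: meet_def apart_def)
  have fin_meet: "finite (meet ?X ?Y `` A)" "finite ((meet ?X ?Y)\<inverse> `` B)" for A B
    by (auto simp: meet_def intro: finite_subset[OF _ fin(1)] finite_subset[OF _ fin(2)])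
  have Z4: "card ?Z \<le> 4"
  proof -
    obtain x where x: "x \<in> S" using S(2) by blast
    have "card ?Z \<le> card (meet ?X ?Y `` {x})" using fin_meet(1) ZS[OF x] by (rule card_mono)
    then show ?thesis using reg x S(1) by (auto simp: biregular_def)
  qed
  have N_card: "card (apart ?X ?Y `` S) + card ?Z = N"
  proof -
    have "apart ?X ?Y `` S \<subseteq> ?Y" by (auto simp: apart_def)
    then show ?thesis
      using fin(2) card_mono[OF fin(2)] card_cyc(2)[OF N(1) N3 v v' disj]
      by (simp add: card_Diff_subset finite_subset)
  qed
  show "apart ?X ?Y `` S = ?Y \<or> card S + 2 \<le> card (apart ?X ?Y `` S)"
  proof (cases "?Z = {}")
    case True
    then show ?thesis by (auto simp: apart_def)
  next
    case False
    then obtain z where z: "z \<in> ?Z" by blast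
    have cS: "card S \<le> card ((meet ?X ?Y)\<inverse> `` {z})" using fin_meet(2) SZ[OF z] by (rule card_mono)
    then have S4: "card S \<le> 4" using reg z by (auto simp: biregular_def)
    have "\<not> (card S = 4 \<and> card ?Z = 4)"
    proof
      assume 4: "card S = 4 \<and> card ?Z = 4"
      have "(meet ?X ?Y)\<inverse> `` {z} = S" if "z \<in> ?Z" for z
        using SZ[OF that] 4 reg that fin_meet
        by (intro sym[OF card_subset_eq]) (auto simp: biregular_def)
      \<comment> \<open>The neighbourhood of \<open>?Z\<close> has only 4 elements, where expansion
        demands at least 6 or all \<open>N\<close>.\<close>
      then have "meet ?Y ?X `` ?Z = S" using False unfolding meet_converse by blast
      moreover have "meet ?Y ?X `` ?Z = ?X \<or> card ?Z + 2 \<le> card (meet ?Y ?X `` ?Z)"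
        using expanding_meet[OF N(1) N3 v' v] disj False
        unfolding expanding_def by (metis Diff_subset Int_commute)
      ultimately show False
        using 4 card_cyc(1)[OF N(1) N3 v v' disj] N(2) by auto
    qed
    moreover have "odd N" "N \<ge> 9" "N \<noteq> 10" using N by auto
    ultimately have "card S + card ?Z + 2 \<le> N" using S4 Z4 by auto
    then show ?thesis using N_card by linarith
  qed
qed (auto simp: apart_def)

text \<open>A common point supplies the two prescribed matching edges: both edges of the first cycle
  at \<open>v 0\<close> meet both edges of the second cycle at that point.\<close>

lemma edge_colourable_meet_cycles:
  assumes N: "odd N" "N \<ge> 3"
    and v: "bij_betw v {..<N} P" and v': "bij_betw v' {..<N} P"
    and disj: "cycle_edges N v \<inter> cycle_edges N v' = {}"
  shows "edge_colourable (cross (meet (cycle_edges N v) (cycle_edges N v')) \<union> cycle_edges N (cycle_edge N v) \<union> cycle_edges N (cycle_edge N v')) 6"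
proof -
  have pos: "0 < N" using N(2) by simp
  then have "v 0 \<in> P" using v by (auto simp: bij_betw_def)
  then obtain a where a: "a < N" "v' a = v 0" using v' by (auto simp: bij_betw_def)
  define u where "u = (if a = 0 then N - 1 else a - 1)"
  have u: "u < N" "Suc u mod N = a" using a pos by (auto simp: u_def)
  have mem: "cycle_edge N k t \<in> cycle_edges N k" if "t < N" for t and k :: "nat \<Rightarrow> 'a"
    using that by (simp add: cycle_edges_def)
  have last: "N - 1 < N" "Suc (N - 1) mod N = 0" using pos by auto
  have "(cycle_edge N v (N - 1), cycle_edge N v' u) \<in> meet (cycle_edges N v) (cycle_edges N v')"
    "(cycle_edge N v (Suc (N - 1) mod N), cycle_edge N v' (Suc u mod N)) \<in> meet (cycle_edges N v) (cycle_edges N v')"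
    using mem[of "N - 1" v] mem[of u v'] mem[of 0 v] mem[of a v'] u last a pos
    by (auto simp: meet_def cycle_edge_def)
  from edge_colourable_two_cycles_expanding[OF N bij_edge[OF N(2) v] bij_edge[OF N(2) v'] disj
      biregular_meet[OF N v v' disj] expanding_meet[OF N v v' disj] last(1) u(1) this]
  show ?thesis by simp
qed

text \<open>The edge \<open>{f 0, f 1}\<close> needs a partner \<open>{g u, g (u + 1)}\<close>,
  indices modulo \<open>N\<close>. \<open>f 0\<close> meets \<open>g u\<close> for only 4 values of
  \<open>u\<close>, and \<open>f 1\<close> meets \<open>g (u + 1)\<close> for only 4, so at most 8
  of the \<open>N\<close> values are excluded.\<close>

lemma edge_colourable_apart_cycles:
  assumes N: "odd N" "N \<ge> 9"
    and v: "bij_betw v {..<N} P" and v': "bij_betw v' {..<N} P"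
    and disj: "cycle_edges N v \<inter> cycle_edges N v' = {}"
    and f: "bij_betw f {..<N} (cycle_edges N v)" and g: "bij_betw g {..<N} (cycle_edges N v')"
  shows "edge_colourable (cross (apart (cycle_edges N v) (cycle_edges N v')) \<union> cycle_edges N f \<union> cycle_edges N g) (N - 2)"
proof -
  let ?R = "apart (cycle_edges N v) (cycle_edges N v')" and ?s = "\<lambda>u. Suc u mod N"
  have N3: "N \<ge> 3" using N(2) by simp
  have s: "bij_betw ?s {..<N} {..<N}" using bij_betw_rotate[of N 1] N3 by simp
  \<comment> \<open>\<open>k\<close> will be the identity and the cyclic successor.\<close>
  have "card {u \<in> {..<N}. f t \<inter> g (k u) \<noteq> {}} = 4"
    if t: "t < N" and k: "bij_betw k {..<N} {..<N}" for t k
  proof -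
    have ft: "f t \<in> cycle_edges N v" using f t by (auto simp: bij_betw_def)
    have gk: "bij_betw (g \<circ> k) {..<N} (cycle_edges N v')" using k g by (rule bij_betw_trans)
    then have im: "(g \<circ> k) ` {..<N} = cycle_edges N v'" and inj: "inj_on (g \<circ> k) {..<N}"
      by (simp_all add: bij_betw_def)
    have img: "(g \<circ> k) ` {u \<in> {..<N}. f t \<inter> g (k u) \<noteq> {}} = meet (cycle_edges N v) (cycle_edges N v') `` {f t}"
      unfolding meet_row[OF ft] im[symmetric] by auto
    have "inj_on (g \<circ> k) {u \<in> {..<N}. f t \<inter> g (k u) \<noteq> {}}"
      using inj by (rule inj_on_subset) auto
    then have "card {u \<in> {..<N}. f t \<inter> g (k u) \<noteq> {}} = card (meet (cycle_edges N v) (cycle_edges N v') `` {f t})"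
      unfolding img[symmetric] by (rule card_image[symmetric])
    also have "\<dots> = 4" by (rule card_row_meet[OF N(1) N3 v v' disj v v' disj ft])
    finally show ?thesis .
  qed
  note bad = this
  have "card {u \<in> {..<N}. f 0 \<inter> g u \<noteq> {}} = 4" "card {u \<in> {..<N}. f 1 \<inter> g (?s u) \<noteq> {}} = 4"
    using bad[of 0 "\<lambda>u. u"] bad[of 1 ?s] s N3 by (auto simp: bij_betw_def)
  then have lt: "card ({u \<in> {..<N}. f 0 \<inter> g u \<noteq> {}} \<union> {u \<in> {..<N}. f 1 \<inter> g (?s u) \<noteq> {}}) < card {..<N}"
    (is "card ?U < _")
    using card_Un_le[of "{u \<in> {..<N}. f 0 \<inter> g u \<noteq> {}}" "{u \<in> {..<N}. f 1 \<inter> g (?s u) \<noteq> {}}"] N(2)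
    by simp
  have "\<exists>u. u < N \<and> f 0 \<inter> g u = {} \<and> f 1 \<inter> g (?s u) = {}"
  proof (rule ccontr)
    assume "\<not> ?thesis"
    then have "{..<N} \<subseteq> ?U" by (intro subsetI) simp
    then have "card {..<N} \<le> card ?U" by (intro card_mono) simp_all
    with lt show False by simp
  qed
  then obtain u where u: "u < N" "f 0 \<inter> g u = {}" "f 1 \<inter> g (?s u) = {}" by (elim exE conjE)
  have "f t \<in> cycle_edges N v" "g t \<in> cycle_edges N v'" if "t < N" for t
    using f g that by (auto simp: bij_betw_def)
  then have "(f 0, g u) \<in> ?R" "(f (Suc 0 mod N), g (?s u)) \<in> ?R"
    using u N3 by (auto simp: apart_def)
  then have "edge_colourable (cross ?R \<union> cycle_edges N f \<union> cycle_edges N g) (N - 4 + 2)"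
    using N3 u(1) by (intro edge_colourable_two_cycles_expanding[OF N(1) N3 f g disj
        biregular_apart_cyc[OF N(1) N3 v v' disj] expanding_apart[OF N v v' disj], of 0 u]) auto
  moreover have "N - 4 + 2 = N - 2" using N(2) by simp
  ultimately show ?thesis by (simp only:)
qed

text \<open>The form for explicit matchings, given as permutations of positions: one pair of
  consecutive positions has to go to consecutive positions in the same order.\<close>

lemma edge_colourable_two_cycles_perm:
  assumes odd: "odd N" "N \<ge> 3"
    and f: "bij_betw f {..<N} X" and g: "bij_betw g {..<N} Y" and disj: "X \<inter> Y = {}"
    and R: "biregular R X Y r"
    and p: "bij_betw p {..<N} {..<N}" "\<And>s. s < N \<Longrightarrow> (f s, g (p s)) \<in> R"
    and t: "t < N" "p (Suc t mod N) = Suc (p t) mod N"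
  shows "edge_colourable (cross R \<union> cycle_edges N f \<union> cycle_edges N g) (r + 2)"
proof -
  let ?\<mu> = "g \<circ> p \<circ> inv_into {..<N} f"
  have inv: "inv_into {..<N} f (f s) = s" if "s < N" for s
    using f that by (simp add: bij_betw_def)
  have "bij_betw ?\<mu> X Y"
    using bij_betw_trans[OF bij_betw_inv_into[OF f] bij_betw_trans[OF p(1) g]]
    by (simp add: comp_assoc)
  moreover have "(x, ?\<mu> x) \<in> R" if "x \<in> X" for x
  proof -
    obtain s where "s < N" "x = f s" using bij_betw_imp_surj_on[OF f] \<open>x \<in> X\<close> by auto
    then show ?thesis using inv p(2) by simp
  qed
  moreover have "p t < N" using p(1) t(1) by (auto simp: bij_betw_def)
  moreover have "Suc t mod N < N" using t(1) by simp
  ultimately show ?thesis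
    using t inv by (intro edge_colourable_two_cycles[OF odd f g disj R, where \<mu> = ?\<mu> and t = t and u = "p t"]) simp_all
qed

section \<open>Rounds of block pairs\<close>

text \<open>The one-factorization of the complete graph on \<open>{..q}\<close>, \<open>q\<close> odd, in which the vertex \<open>q\<close>
  is the point at infinity and the round of an edge between finite vertices is their sum mod \<open>q\<close>.\<close>

definition round_index :: "nat \<Rightarrow> nat \<Rightarrow> nat \<Rightarrow> nat" where
  "round_index q b c = (if c = q then 2 * b else if b = q then 2 * c else b + c) mod q"

lemma round_index_commute: "round_index q b c = round_index q c b"
  by (simp add: round_index_def add.commute)

lemma double_mod_eqD:
  fixes b c q :: nat
  assumes "odd q" "b < q" "c < q" "2 * b mod q = 2 * c mod q"
  shows "b = c"
proof -
  have "b \<le> c \<or> c \<le> b" by linarith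
  then show ?thesis
  proof
    assume "b \<le> c"
    then have "q dvd 2 * (c - b)"
      using assms(4) mod_eq_dvd_iff_nat[of "2 * b" "2 * c" q] by (simp add: right_diff_distrib' eq_commute)
    then have "q dvd c - b" using assms(1) by (simp add: coprime_dvd_mult_right_iff)
    then show ?thesis using assms(3) \<open>b \<le> c\<close> by (auto dest: dvd_imp_le)
  next
    assume "c \<le> b"
    then have "q dvd 2 * (b - c)"
      using assms(4) mod_eq_dvd_iff_nat[of "2 * c" "2 * b" q] by (simp add: right_diff_distrib')
    then have "q dvd b - c" using assms(1) by (simp add: coprime_dvd_mult_right_iff)
    then show ?thesis using assms(2) \<open>c \<le> b\<close> by (auto dest: dvd_imp_le)
  qed
qed

lemma add_mod_eqD:
  fixes b c d q :: nat
  assumes "c < q" "d < q" "(b + c) mod q = (b + d) mod q"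
  shows "c = d"
proof -
  have inj: "inj_on (\<lambda>t. (t + b) mod q) {..<q}"
    using bij_betw_rotate[of q b] assms(1) by (simp add: bij_betw_def)
  have eq: "(c + b) mod q = (d + b) mod q" using assms(3) by (simp only: add.commute)
  show ?thesis by (rule inj_onD[OF inj eq]) (use assms in simp_all)
qed

text \<open>Seen from a finite \<open>b\<close>, the point \<open>q\<close> behaves like
  \<open>b\<close> itself, since \<open>2 * b = b + b\<close>, and adding \<open>b\<close> is
  injective modulo \<open>q\<close>. Seen from \<open>q\<close>, doubling is injective because
  \<open>q\<close> is odd.\<close>

lemma round_index_inject:
  assumes q: "odd q" and b: "b \<le> q" "c \<le> q" "d \<le> q" "b \<noteq> c" "b \<noteq> d"
    and eq: "round_index q b c = round_index q b d"
  shows "c = d"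
proof (cases "b = q")
  case True
  then show ?thesis using b eq double_mod_eqD[OF q, of c d] by (simp add: round_index_def)
next
  case False
  then have bq: "b < q" using b(1) by simp
  have round_index_b: "round_index q b e = (b + (if e = q then b else e)) mod q" for e
    using False by (simp add: round_index_def mult_2)
  have "(if c = q then b else c) < q" "(if d = q then b else d) < q" using b bq by auto
  from add_mod_eqD[OF this] eq[unfolded round_index_b]
  have "(if c = q then b else c) = (if d = q then b else d)" .
  then show ?thesis using b by (simp split: if_splits)
qed

text \<open>The partner of \<open>b\<close> is \<open>-b\<close> modulo \<open>q\<close>, with 0 and
  \<open>q\<close> paired. For odd \<open>m\<close>, round 0 is the one that absorbs the inner
  cycles of the blocks.\<close>

lemma round_index_zero_partner:
  assumes "odd q" "b \<le> q"
  shows "\<exists>c\<le>q. c \<noteq> b \<and> round_index q b c = 0"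
proof -
  consider "b = q" | "b = 0" "b \<noteq> q" | "0 < b" "b < q" using assms(2) by linarith
  then show ?thesis
  proof cases
    case 1
    then show ?thesis using odd_pos[OF assms(1)] by (intro exI[of _ 0]) (auto simp: round_index_def)
  next
    case 2
    then show ?thesis by (intro exI[of _ q]) (auto simp: round_index_def)
  next
    case 3
    moreover have "q - b \<noteq> b" using 3 assms(1) by presburger
    ultimately show ?thesis by (intro exI[of _ "q - b"]) (auto simp: round_index_def)
  qed
qed

text \<open>\<open>F b c\<close> is what block \<open>b\<close> contributes to its pair with
  \<open>c\<close>, so it need not be symmetric. Pairs in one round are disjoint and share that
  round's colours; different rounds use different colours.\<close>

lemma edge_colourable_blocks:
  fixes B :: "nat \<Rightarrow> 'a set"
  assumes q: "odd q"
    and disj: "\<And>b c. b \<le> q \<Longrightarrow> c \<le> q \<Longrightarrow> b \<noteq> c \<Longrightarrow> B b \<inter> B c = {}"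
    and F: "\<And>b c e. b \<le> q \<Longrightarrow> c \<le> q \<Longrightarrow> b \<noteq> c \<Longrightarrow> e \<in> F b c \<Longrightarrow> e \<subseteq> B b \<union> B c"
    and col: "\<And>b c. b < c \<Longrightarrow> c \<le> q \<Longrightarrow> edge_colourable (F b c \<union> F c b) (D (round_index q b c))"
    and E: "\<And>e. e \<in> E \<Longrightarrow> \<exists>b\<le>q. \<exists>c\<le>q. b \<noteq> c \<and> e \<in> F b c"
  shows "edge_colourable E (\<Sum>r<q. D r)"
proof -
  define \<E> where "\<E> r = {F b c \<union> F c b | b c. b \<le> q \<and> c \<le> q \<and> b \<noteq> c \<and> round_index q b c = r}" for r
  have "edge_colourable (\<Union>(\<E> r)) (D r)" for r
  proof (rule edge_colourable_Union_disjoint)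
    fix X assume "X \<in> \<E> r"
    then obtain b c where bc: "X = F b c \<union> F c b" "b \<le> q" "c \<le> q" "b \<noteq> c" "round_index q b c = r"
      unfolding \<E>_def by blast
    consider "b < c" | "c < b" using bc(4) by linarith
    then show "edge_colourable X (D r)"
      by cases (use col[of b c] col[of c b] bc round_index_commute[of q b c] in \<open>simp_all add: Un_commute\<close>)
  next
    fix X Y e f assume XY: "X \<in> \<E> r" "Y \<in> \<E> r" "X \<noteq> Y" "e \<in> X" "f \<in> Y"
    obtain b c where bc: "X = F b c \<union> F c b" "b \<le> q" "c \<le> q" "b \<noteq> c" "round_index q b c = r"
      using XY(1) unfolding \<E>_def by blast
    obtain b' c' where bc': "Y = F b' c' \<union> F c' b'" "b' \<le> q" "c' \<le> q" "b' \<noteq> c'" "round_index q b' c' = r"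
      using XY(2) unfolding \<E>_def by blast
    \<comment> \<open>Two pairs of the same round that share a block coincide.\<close>
    have "b \<noteq> b'" using round_index_inject[OF q, of b c c'] bc bc' XY(3) by auto
    moreover have "b \<noteq> c'"
      using round_index_inject[OF q, of b c b'] bc bc' XY(3) round_index_commute[of q b' c'] by auto
    moreover have "c \<noteq> b'"
      using round_index_inject[OF q, of c b c'] bc bc' XY(3) round_index_commute[of q b c] by auto
    moreover have "c \<noteq> c'"
      using round_index_inject[OF q, of c b b'] bc bc' XY(3) round_index_commute[of q b' c'] round_index_commute[of q b c] by auto
    moreover have "e \<subseteq> B b \<union> B c" using XY(4) bc F[of b c e] F[of c b e] by auto
    moreover have "f \<subseteq> B b' \<union> B c'" using XY(5) bc' F[of b' c' f] F[of c' b' f] by auto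
    ultimately show "e \<inter> f = {}"
      using disj[of b b'] disj[of b c'] disj[of c b'] disj[of c c'] bc(2,3) bc'(2,3) by blast
  qed
  then have "edge_colourable (\<Union>r<q. \<Union>(\<E> r)) (\<Sum>r<q. D r)" by (rule edge_colourable_UN)
  moreover have "E \<subseteq> (\<Union>r<q. \<Union>(\<E> r))"
  proof
    fix e assume "e \<in> E"
    then obtain b c where bc: "b \<le> q" "c \<le> q" "b \<noteq> c" "e \<in> F b c" using E by blast
    have "round_index q b c < q" using odd_pos[OF q] by (simp add: round_index_def)
    moreover have "F b c \<union> F c b \<in> \<E> (round_index q b c)" using bc by (auto simp: \<E>_def)
    ultimately show "e \<in> (\<Union>r<q. \<Union>(\<E> r))" using bc(4) by blast
  qed
  ultimately show ?thesis by (rule edge_colourable_mono)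
qed

section \<open>Triangular graphs and their complements\<close>

lemma finite_verts_triangular: "finite (verts (triangular_graph m))"
  using simple_graph_triangular_graph by (simp add: simple_graph_def)

lemma finite_edges:
  assumes "simple_graph G"
  shows "finite (edges G)"
proof (rule finite_subset)
  show "edges G \<subseteq> Pow (verts G)" using assms by (auto simp: simple_graph_def)
  show "finite (Pow (verts G))" using assms by (simp add: simple_graph_def)
qed

lemma degree_geI:
  assumes "simple_graph G" "\<And>f. f \<in> A \<Longrightarrow> {v, f} \<in> edges G"
  shows "card A \<le> degree G v"
proof -
  have "v \<noteq> f" if "f \<in> A" for f
  proof -
    have "card {v, f} = 2" using assms(2)[OF that] assms(1) unfolding simple_graph_def by blast
    then show ?thesis by auto
  qed
  then have "inj_on (\<lambda>f. {v, f}) A" by (auto simp: inj_on_def doubleton_eq_iff)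
  then have "card A = card ((\<lambda>f. {v, f}) ` A)" by (simp add: card_image)
  also have "\<dots> \<le> card {e \<in> edges G. v \<in> e}"
    using assms finite_edges[OF assms(1)] by (intro card_mono) auto
  finally show ?thesis by (simp add: degree_def)
qed

lemma degree_triangular:
  assumes "m \<ge> 2"
  shows "2 * (m - 2) \<le> degree (triangular_graph m) {0, 1}"
proof -
  let ?A = "\<lambda>i. (\<lambda>a. {i, a}) ` {2..<m}"
  have "card (?A i) = m - 2" for i :: nat
    by (subst card_image) (auto simp: inj_on_def doubleton_eq_iff)
  then have "card (?A 0) = m - 2" "card (?A 1) = m - 2" by blast+
  moreover have "?A 0 \<inter> ?A 1 = {}"
  proof (rule ccontr)
    assume "?A 0 \<inter> ?A 1 \<noteq> {}"
    then obtain f where f: "f \<in> ?A 0" "f \<in> ?A 1" by blast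
    have "0 \<in> f" using f(1) by auto
    moreover obtain b where "f = {1, b}" "2 \<le> b" using f(2) by auto
    ultimately show False by simp
  qed
  ultimately have "card (?A 0 \<union> ?A 1) = 2 * (m - 2)" by (subst card_Un_disjoint) simp_all
  moreover have "{{0, 1}, f} \<in> edges (triangular_graph m)" if "f \<in> ?A 0 \<union> ?A 1" for f
  proof -
    obtain i a where f: "f = {i, a}" "i = 0 \<or> i = 1" "2 \<le> a" "a < m" using \<open>f \<in> _\<close> by auto
    have "{0, 1} \<in> verts (triangular_graph m)"
      using assms by (simp add: verts_triangular_graph)
    moreover have "f \<in> verts (triangular_graph m)"
      using f by (auto simp: verts_triangular_graph)
    moreover have "a \<in> f" "a \<notin> {0, 1}" "i \<in> {0, 1} \<inter> f" using f by auto
    then have "{0, 1} \<noteq> f" "{0, 1} \<inter> f \<noteq> {}" by blast+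
    ultimately show ?thesis
      unfolding triangular_graph_def line_graph_def by auto
  qed
  ultimately show ?thesis
    using degree_geI[OF simple_graph_triangular_graph, of "?A 0 \<union> ?A 1"] by metis
qed

lemma triangular_edgeD:
  assumes "{e, f} \<in> edges (triangular_graph m)"
  shows "e \<noteq> f" "e \<inter> f \<noteq> {}"
  using assms by (auto simp: triangular_graph_def line_graph_def doubleton_eq_iff)

lemma degree_complement_triangular:
  assumes "m \<ge> 2"
  shows "(m - 2) choose 2 \<le> degree (graph_complement (triangular_graph m)) {0, 1}"
proof -
  let ?A = "{f. f \<subseteq> {2..<m} \<and> card f = 2}"
  have "{{0, 1}, f} \<in> edges (graph_complement (triangular_graph m))" if "f \<in> ?A" for f
  proof -
    have "f \<in> verts (triangular_graph m)" "{0, 1} \<in> verts (triangular_graph m)"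
      using that assms by (auto simp: verts_triangular_graph)
    moreover have int: "{0, 1} \<inter> f = {}" using that by auto
    moreover have "{{0, 1}, f} \<notin> edges (triangular_graph m)"
      using triangular_edgeD(2) int by blast
    moreover have "{0, 1} \<noteq> f" using int by auto
    ultimately show ?thesis by (simp add: graph_complement_def)
  qed
  then have "card ?A \<le> degree (graph_complement (triangular_graph m)) {0, 1}"
    by (intro degree_geI simple_graph_graph_complement simple_graph_triangular_graph)
  moreover have "card ?A = (m - 2) choose 2" by (subst n_subsets) simp_all
  ultimately show ?thesis by simp
qed

lemma triangular_class_1I:
  assumes "m \<ge> 2" "edge_colourable (edges (triangular_graph m)) (2 * (m - 2))"
  shows "class_1 (triangular_graph m)"
  using assms degree_triangular[OF assms(1)]
  by (intro class_1I[of _ "{0, 1}"] finite_verts_triangular finite_edges simple_graph_triangular_graph)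
    (auto simp: verts_triangular_graph)

lemma complement_triangular_class_1I:
  assumes "m \<ge> 2" "edge_colourable (edges (graph_complement (triangular_graph m))) ((m - 2) choose 2)"
  shows "class_1 (graph_complement (triangular_graph m))"
  using assms degree_complement_triangular[OF assms(1)]
  by (intro class_1I[of _ "{0, 1}"] finite_edges simple_graph_graph_complement simple_graph_triangular_graph)
    (auto simp: graph_complement_def finite_verts_triangular verts_triangular_graph)

lemma cross_meet_commute: "cross (meet X Y) = cross (meet Y X)"
  by (auto simp: cross_def meet_def insert_commute Int_commute image_iff)

lemma cross_apart_commute: "cross (apart X Y) = cross (apart Y X)"
  by (auto simp: cross_def apart_def insert_commute Int_commute image_iff)

lemma cross_meetI: "x \<in> X \<Longrightarrow> y \<in> Y \<Longrightarrow> x \<inter> y \<noteq> {} \<Longrightarrow> {x, y} \<in> cross (meet X Y)"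
  by (auto simp: cross_def meet_def)

lemma cross_apartI: "x \<in> X \<Longrightarrow> y \<in> Y \<Longrightarrow> x \<inter> y = {} \<Longrightarrow> {x, y} \<in> cross (apart X Y)"
  by (auto simp: cross_def apart_def)

lemma cross_meet_subset: "e \<in> cross (meet X Y) \<Longrightarrow> e \<subseteq> X \<union> Y"
  by (auto simp: cross_def meet_def)

lemma cross_apart_subset: "e \<in> cross (apart X Y) \<Longrightarrow> e \<subseteq> X \<union> Y"
  by (auto simp: cross_def apart_def)

lemma cyc_comp: "{x, y} \<in> cycle_edges N s \<Longrightarrow> {f x, f y} \<in> cycle_edges N (f \<circ> s)"
proof -
  assume "{x, y} \<in> cycle_edges N s"
  then obtain t where t: "t < N" "{x, y} = cycle_edge N s t" by (auto simp: cycle_edges_def)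
  have "{f x, f y} = f ` {x, y}" by simp
  also have "\<dots> = cycle_edge N (f \<circ> s) t" unfolding t(2) by (simp add: cycle_edge_def)
  finally show ?thesis using t(1) by (auto simp: cycle_edges_def)
qed

lemma triangular_edgeE:
  assumes "e \<in> edges (triangular_graph m)"
  obtains x y where "e = {x, y}" "x \<noteq> y" "x \<inter> y \<noteq> {}"
    "x \<subseteq> {..<m}" "card x = 2" "y \<subseteq> {..<m}" "card y = 2"
  using assms unfolding triangular_graph_def line_graph_def complete_graph_def by auto

lemma complement_triangular_edgeE:
  assumes "e \<in> edges (graph_complement (triangular_graph m))"
  obtains x y where "e = {x, y}" "x \<noteq> y" "x \<inter> y = {}"
    "x \<subseteq> {..<m}" "card x = 2" "y \<subseteq> {..<m}" "card y = 2"
proof -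
  have e: "e \<subseteq> verts (triangular_graph m)" "card e = 2" "e \<notin> edges (triangular_graph m)"
    using assms by (simp_all add: graph_complement_def)
  then obtain x y where xy: "e = {x, y}" "x \<noteq> y" by (auto simp: card_2_iff)
  then have V: "x \<subseteq> {..<m}" "card x = 2" "y \<subseteq> {..<m}" "card y = 2"
    using e(1) by (auto simp: verts_triangular_graph)
  have "x \<inter> y = {}"
    using e(3) xy V unfolding triangular_graph_def line_graph_def complete_graph_def by auto
  then show thesis using xy V by (intro that)
qed

section \<open>Colourings from a Hamiltonian decomposition\<close>

text \<open>The cycles \<open>w i\<close> play two roles: the edges of \<open>w b\<close> form the \<open>b\<close>-th block of vertices of the
  triangular graph, and, as \<open>w 0\<close> is the identity, the cycles \<open>w 1, \<dots>, w (n - 1)\<close> of indices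
  decompose the pairs of disjoint edges inside a block.\<close>

locale hamilton_decomposition =
  fixes N n :: nat and w :: "nat \<Rightarrow> nat \<Rightarrow> nat"
  assumes N: "N = Suc (2 * n)" and n: "n > 0"
    and bij: "i < n \<Longrightarrow> bij_betw (w i) {..<N} {..<N}"
    and cover: "x < N \<Longrightarrow> y < N \<Longrightarrow> x \<noteq> y \<Longrightarrow> \<exists>i<n. {x, y} \<in> cycle_edges N (w i)"
    and w0: "t < N \<Longrightarrow> w 0 t = t"
begin

lemma oddN: "odd N" and N3: "N \<ge> 3"
  using N n by simp_all

text \<open>The covering assumption becomes exact by counting: \<open>n * N\<close> positions cover
  the \<open>N choose 2 = n * N\<close> pairs, so none is covered twice.\<close>

lemma cyc_disjoint:
  assumes "i < n" "j < n" "i \<noteq> j"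
  shows "cycle_edges N (w i) \<inter> cycle_edges N (w j) = {}"
proof -
  let ?F = "\<lambda>(i, t). cycle_edge N (w i) t" and ?I = "{..<n} \<times> {..<N}"
  let ?P = "{e. e \<subseteq> {..<N} \<and> card e = 2}"
  have "?P \<subseteq> ?F ` ?I"
  proof
    fix e assume "e \<in> ?P"
    then obtain x y where "e = {x, y}" "x < N" "y < N" "x \<noteq> y" by (auto simp: card_2_iff)
    with cover[of x y] show "e \<in> ?F ` ?I" by (fastforce simp: cycle_edges_def)
  qed
  then have "card ?P \<le> card (?F ` ?I)" by (intro card_mono) auto
  moreover have "card ?P = N choose 2" by (subst n_subsets) simp_all
  moreover have "N choose 2 = n * N" by (simp add: choose_two N)
  ultimately have "card (?F ` ?I) = card ?I"
    using card_image_le[of ?I ?F] by simp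
  then have "inj_on ?F ?I" by (intro eq_card_imp_inj_on) auto
  then show ?thesis
    using assms by (fastforce simp: cycle_edges_def inj_on_def)
qed

lemma vertex_block:
  assumes "x \<subseteq> {..<N}" "card x = 2"
  shows "\<exists>b<n. x \<in> cycle_edges N (w b)"
proof -
  obtain p q where "x = {p, q}" "p \<noteq> q" using assms(2) by (auto simp: card_2_iff)
  with assms(1) cover[of p q] show ?thesis by auto
qed

lemma bij_edge_w: "b < n \<Longrightarrow> bij_betw (cycle_edge N (w b)) {..<N} (cycle_edges N (w b))"
  using bij_edge[OF N3 bij] .

lemma bij_edge_comp:
  "b < n \<Longrightarrow> a < n \<Longrightarrow> bij_betw (cycle_edge N (w b) \<circ> w a) {..<N} (cycle_edges N (w b))"
  using bij_betw_trans[OF bij bij_edge_w] .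

lemma biregular_meet_w:
  "b < n \<Longrightarrow> c < n \<Longrightarrow> b \<noteq> c \<Longrightarrow> biregular (meet (cycle_edges N (w b)) (cycle_edges N (w c))) (cycle_edges N (w b)) (cycle_edges N (w c)) 4"
  using biregular_meet[OF oddN N3 bij bij cyc_disjoint] .

lemma biregular_apart_w:
  "b < n \<Longrightarrow> c < n \<Longrightarrow> b \<noteq> c \<Longrightarrow> biregular (apart (cycle_edges N (w b)) (cycle_edges N (w c))) (cycle_edges N (w b)) (cycle_edges N (w c)) (N - 4)"
  using biregular_apart_cyc[OF oddN N3 bij bij cyc_disjoint] .

lemma meeting_in_block:
  assumes "b < n" "x \<in> cycle_edges N (w b)" "y \<in> cycle_edges N (w b)" "x \<noteq> y" "x \<inter> y \<noteq> {}"
  shows "{x, y} \<in> cycle_edges N (cycle_edge N (w b))"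
proof -
  obtain s t where "s < N" "x = cycle_edge N (w b) s" "t < N" "y = cycle_edge N (w b) t"
    using assms(2,3) by (auto simp: cycle_edges_def)
  then show ?thesis using meeting_edges_in_cyc[OF N3 bij[OF assms(1)], of s t] assms(4,5) by auto
qed

text \<open>The positions of \<open>x\<close> and \<open>y\<close> are joined by some cycle
  \<open>w a\<close>; \<open>a = 0\<close> would make them consecutive, and then \<open>x\<close>
  and \<open>y\<close> would meet.\<close>

lemma apart_in_block:
  assumes "b < n" "x \<in> cycle_edges N (w b)" "y \<in> cycle_edges N (w b)" "x \<noteq> y" "x \<inter> y = {}"
  shows "\<exists>a. 0 < a \<and> a < n \<and> {x, y} \<in> cycle_edges N (cycle_edge N (w b) \<circ> w a)"
proof -
  obtain s t where st: "s < N" "x = cycle_edge N (w b) s" "t < N" "y = cycle_edge N (w b) t"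
    using assms(2,3) by (auto simp: cycle_edges_def)
  then obtain a where a: "a < n" "{s, t} \<in> cycle_edges N (w a)"
    using cover[of s t] assms(4) by auto
  have "a \<noteq> 0"
  proof
    assume "a = 0"
    then obtain r where "r < N" "{s, t} = {r, Suc r mod N}"
      using a(2) N3 by (auto simp: cycle_edges_def cycle_edge_def w0)
    then have "t = Suc s mod N \<or> s = Suc t mod N" by (auto simp: doubleton_eq_iff)
    then show False using st assms(5) by (auto simp: cycle_edge_def)
  qed
  then show ?thesis using cyc_comp[OF a(2), of "cycle_edge N (w b)"] st a(1) by auto
qed

text \<open>The index \<open>c - b\<close> modulo \<open>n\<close> runs through \<open>1, \<dots>, n - 1\<close>, so block \<open>b\<close> spends each of its cycles
  of disjoint pairs on exactly one other block \<open>c\<close>.\<close>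

definition kneser_part :: "nat \<Rightarrow> nat \<Rightarrow> nat set set set" where
  "kneser_part b c =
     cross (apart (cycle_edges N (w b)) (cycle_edges N (w c))) \<union> cycle_edges N (cycle_edge N (w b) \<circ> w ((c + n - b) mod n))"

lemma kneser_part_subset:
  assumes "b < n" "e \<in> kneser_part b c"
  shows "e \<subseteq> cycle_edges N (w b) \<union> cycle_edges N (w c)"
proof -
  have "(c + n - b) mod n < n" using n by simp
  from cyc_subset[OF N3 bij_edge_comp[OF assms(1) this]] show ?thesis
    using assms(2) cross_apart_subset unfolding kneser_part_def by blast
qed

lemma apart_in_kneser_part:
  assumes "b < n" "x \<in> cycle_edges N (w b)" "y \<in> cycle_edges N (w b)" "x \<noteq> y" "x \<inter> y = {}"
  shows "\<exists>c<n. b \<noteq> c \<and> {x, y} \<in> kneser_part b c"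
proof -
  obtain a where a: "0 < a" "a < n" "{x, y} \<in> cycle_edges N (cycle_edge N (w b) \<circ> w a)"
    using apart_in_block[OF assms] by blast
  \<comment> \<open>\<open>c\<close> is \<open>b + a\<close> reduced modulo \<open>n\<close>; it
    differs from \<open>b\<close> since \<open>0 < a < n\<close>.\<close>
  define c where "c = (if b + a < n then b + a else b + a - n)"
  have "c < n" "b \<noteq> c" "(c + n - b) mod n = a"
    using assms(1) a by (auto simp: c_def mod_if)
  then show ?thesis using a(3) by (auto simp: kneser_part_def)
qed

text \<open>The bound is \<open>N - 4\<close> for the graph of disjoint pairs plus 2 for the cycles.
  It is kept as a property of the decomposition because small \<open>N\<close> needs its own
  argument.\<close>

definition kneser_colourable :: bool where
  "kneser_colourable \<longleftrightarrow>
     (\<forall>b c. b < c \<longrightarrow> c < n \<longrightarrow> edge_colourable (kneser_part b c \<union> kneser_part c b) (N - 2))"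

lemma kneser_part_Un:
  "kneser_part b c \<union> kneser_part c b = cross (apart (cycle_edges N (w b)) (cycle_edges N (w c))) \<union>
     cycle_edges N (cycle_edge N (w b) \<circ> w ((c + n - b) mod n)) \<union> cycle_edges N (cycle_edge N (w c) \<circ> w ((b + n - c) mod n))"
  using cross_apart_commute[of "cycle_edges N (w c)" "cycle_edges N (w b)"] by (auto simp: kneser_part_def)

lemma kneser_colourableI:
  assumes "N \<ge> 9"
  shows kneser_colourable
  unfolding kneser_colourable_def
proof (intro allI impI)
  fix b c assume bc: "b < c" "c < n"
  then have "b < n" "b \<noteq> c" by simp_all
  moreover have "(c + n - b) mod n < n" "(b + n - c) mod n < n" using n by simp_all
  ultimately show "edge_colourable (kneser_part b c \<union> kneser_part c b) (N - 2)"
    unfolding kneser_part_Un using bc(2)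
    by (intro edge_colourable_apart_cycles[where P = "{..<N}", OF oddN assms] bij cyc_disjoint bij_edge_comp)
qed

text \<open>\<open>n\<close> blocks give \<open>n - 1\<close> rounds of 4 colours, and round 0 takes
  2 more for the inner cycle of every block: \<open>4 * (n - 1) + 2 = 2 * (N - 2)\<close>.\<close>

lemma edge_colourable_triangular_odd:
  assumes "even n"
  shows "edge_colourable (edges (triangular_graph N)) (2 * (N - 2))"
proof -
  define q where "q = n - 1"
  have q: "odd q" "n = Suc q" using assms n by (auto simp: q_def)
  let ?F = "\<lambda>b c. cross (meet (cycle_edges N (w b)) (cycle_edges N (w c))) \<union>
    (if round_index q b c = 0 then cycle_edges N (cycle_edge N (w b)) else {})"
  let ?D = "\<lambda>r::nat. if r = 0 then 6 else 4 :: nat"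
  have "edge_colourable (edges (triangular_graph N)) (\<Sum>r<q. ?D r)"
  proof (rule edge_colourable_blocks[where B = "\<lambda>b. cycle_edges N (w b)" and F = ?F])
    show "odd q" by (fact q(1))
    show "cycle_edges N (w b) \<inter> cycle_edges N (w c) = {}" if "b \<le> q" "c \<le> q" "b \<noteq> c" for b c
      using that cyc_disjoint q(2) by simp
    show "e \<subseteq> cycle_edges N (w b) \<union> cycle_edges N (w c)" if "b \<le> q" "c \<le> q" "b \<noteq> c" "e \<in> ?F b c" for b c e
      using that cross_meet_subset cyc_subset[OF N3 bij_edge_w, of b e] q(2)
      by (auto split: if_splits)
    show "edge_colourable (?F b c \<union> ?F c b) (?D (round_index q b c))" if bc: "b < c" "c \<le> q" for b c
    proof -
      have bcn: "b < n" "c < n" "b \<noteq> c" using bc q(2) by simp_all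
      note disj = cyc_disjoint[OF bcn]
      have "?F b c \<union> ?F c b = cross (meet (cycle_edges N (w b)) (cycle_edges N (w c))) \<union>
          (if round_index q b c = 0 then cycle_edges N (cycle_edge N (w b)) else {}) \<union> (if round_index q b c = 0 then cycle_edges N (cycle_edge N (w c)) else {})"
        using cross_meet_commute[of "cycle_edges N (w c)" "cycle_edges N (w b)"] round_index_commute[of q b c] by auto
      moreover have "edge_colourable (cross (meet (cycle_edges N (w b)) (cycle_edges N (w c)))) 4"
        by (rule koenig[OF biregular_meet_w[OF bcn] _ _ disj]) (simp_all add: cycle_edges_def)
      ultimately show ?thesis
        using edge_colourable_meet_cycles[OF oddN N3 bij bij disj] bcn(1,2) by simp
    qed
    fix e assume "e \<in> edges (triangular_graph N)"
    then obtain x y where e: "e = {x, y}" "x \<noteq> y" "x \<inter> y \<noteq> {}"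
        "x \<subseteq> {..<N}" "card x = 2" "y \<subseteq> {..<N}" "card y = 2"
      by (rule triangular_edgeE)
    obtain b c where bc: "b < n" "x \<in> cycle_edges N (w b)" "c < n" "y \<in> cycle_edges N (w c)"
      using vertex_block[OF e(4,5)] vertex_block[OF e(6,7)] by blast
    show "\<exists>b\<le>q. \<exists>c\<le>q. b \<noteq> c \<and> e \<in> ?F b c"
    proof (cases "b = c")
      case True
      obtain d where "d \<le> q" "d \<noteq> b" "round_index q b d = 0"
        using round_index_zero_partner[OF q(1), of b] bc(1) q(2) by auto
      moreover have "e \<in> cycle_edges N (cycle_edge N (w b))"
        using meeting_in_block[OF bc(1,2)] bc(4) True e by simp
      ultimately show ?thesis using bc(1) q(2) by (intro exI[of _ b] exI[of _ d] conjI) auto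
    next
      case False
      moreover have "e \<in> cross (meet (cycle_edges N (w b)) (cycle_edges N (w c)))"
        unfolding e(1) using bc(2,4) e(3) by (rule cross_meetI)
      ultimately show ?thesis using bc(1,3) q(2) by (intro exI[of _ b] exI[of _ c] conjI) auto
    qed
  qed
  moreover have "(\<Sum>r<q. ?D r) = (\<Sum>r<q. 4 + (if r = 0 then 2 else 0))"
    by (intro sum.cong) auto
  then have "(\<Sum>r<q. ?D r) = 2 * (N - 2)"
    using odd_pos[OF q(1)] by (simp add: sum.distrib sum.delta' N q(2))
  ultimately show ?thesis by simp
qed

text \<open>\<open>n - 1\<close> rounds of \<open>N - 2 = 2 * n - 1\<close> colours make exactly
  \<open>(N - 2) choose 2\<close>.\<close>

lemma edge_colourable_complement_odd:
  assumes "even n" kneser_colourable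
  shows "edge_colourable (edges (graph_complement (triangular_graph N))) ((N - 2) choose 2)"
proof -
  define q where "q = n - 1"
  have q: "odd q" "n = Suc q" using assms n by (auto simp: q_def)
  have "edge_colourable (edges (graph_complement (triangular_graph N))) (\<Sum>r<q. N - 2)"
  proof (rule edge_colourable_blocks[where B = "\<lambda>b. cycle_edges N (w b)" and F = kneser_part])
    show "odd q" by (fact q(1))
    show "cycle_edges N (w b) \<inter> cycle_edges N (w c) = {}" if "b \<le> q" "c \<le> q" "b \<noteq> c" for b c
      using that cyc_disjoint q(2) by simp
    show "e \<subseteq> cycle_edges N (w b) \<union> cycle_edges N (w c)" if "b \<le> q" "c \<le> q" "b \<noteq> c" "e \<in> kneser_part b c" for b c e
      using that kneser_part_subset q(2) by simp
    show "edge_colourable (kneser_part b c \<union> kneser_part c b) (N - 2)" if "b < c" "c \<le> q" for b c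
    proof -
      have "c < n" using that(2) q(2) by simp
      then show ?thesis using assms(2) that(1) unfolding kneser_colourable_def by blast
    qed
    fix e assume "e \<in> edges (graph_complement (triangular_graph N))"
    then obtain x y where e: "e = {x, y}" "x \<noteq> y" "x \<inter> y = {}"
        "x \<subseteq> {..<N}" "card x = 2" "y \<subseteq> {..<N}" "card y = 2"
      by (rule complement_triangular_edgeE)
    obtain b c where bc: "b < n" "x \<in> cycle_edges N (w b)" "c < n" "y \<in> cycle_edges N (w c)"
      using vertex_block[OF e(4,5)] vertex_block[OF e(6,7)] by blast
    have "\<exists>b<n. \<exists>c<n. b \<noteq> c \<and> e \<in> kneser_part b c"
    proof (cases "b = c")
      case True
      then show ?thesis using apart_in_kneser_part[OF bc(1,2)] bc e by blast
    next
      case False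
      then have "e \<in> kneser_part b c"
        using cross_apartI[OF bc(2,4) e(3)] unfolding kneser_part_def e(1) by blast
      then show ?thesis using False bc by blast
    qed
    then show "\<exists>b\<le>q. \<exists>c\<le>q. b \<noteq> c \<and> e \<in> kneser_part b c"
      using q(2) less_Suc_eq_le by auto
  qed
  moreover have "(\<Sum>r<q. N - 2) = (N - 2) choose 2"
    by (simp add: choose_two N q(2))
  ultimately show ?thesis by simp
qed

end

section \<open>Even order: the block of pairs through an additional point\<close>

context hamilton_decomposition
begin

definition star :: "nat \<Rightarrow> nat set" where
  "star x = {N, x}"

definition block :: "nat \<Rightarrow> nat set set" where
  "block b = (if b < n then cycle_edges N (w b) else star ` {..<N})"

lemma bij_star: "bij_betw star {..<N} (star ` {..<N})"
  by (auto simp: bij_betw_def inj_on_def star_def doubleton_eq_iff)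

lemma cyc_star_disjoint: "b < n \<Longrightarrow> cycle_edges N (w b) \<inter> star ` {..<N} = {}"
  using cyc_subset[OF N3 bij] by (fastforce simp: star_def)

lemma block_disjoint:
  assumes "b \<le> n" "c \<le> n" "b \<noteq> c"
  shows "block b \<inter> block c = {}"
proof -
  consider "b < n" "c < n" | "b < n" "c = n" | "b = n" "c < n" using assms by linarith
  then show ?thesis
    by cases (use assms(3) cyc_disjoint[of b c] cyc_star_disjoint[of b] cyc_star_disjoint[of c] in \<open>auto simp: block_def\<close>)
qed

lemma vertex_block':
  assumes "x \<subseteq> {..<Suc N}" "card x = 2"
  shows "\<exists>b\<le>n. x \<in> block b"
proof (cases "N \<in> x")
  case True
  then obtain p where p: "x = {N, p}" "p \<noteq> N"
    using assms(2) by (auto simp: card_2_iff)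
  then have "x \<in> block n" using assms(1) by (auto simp: block_def star_def)
  then show ?thesis by blast
next
  case False
  then have "x \<subseteq> {..<N}" using assms(1) by (auto simp: less_Suc_eq)
  then obtain b where "b < n" "x \<in> cycle_edges N (w b)" using vertex_block[OF _ assms(2)] by blast
  then show ?thesis by (intro exI[of _ b]) (simp add: block_def)
qed

lemma biregular_meet_star:
  assumes "b < n"
  shows "biregular (meet (cycle_edges N (w b)) (star ` {..<N})) (cycle_edges N (w b)) (star ` {..<N}) 2"
proof -
  have "card (meet (cycle_edges N (w b)) (star ` {..<N}) `` {e}) = 2" if e: "e \<in> cycle_edges N (w b)" for e
  proof -
    have sub: "e \<subseteq> {..<N}" using cyc_subset[OF N3 bij[OF assms] e] .
    have "card e = 2" using e card_edge[OF N3 bij[OF assms]] by (auto simp: cycle_edges_def)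
    moreover have "meet (cycle_edges N (w b)) (star ` {..<N}) `` {e} = star ` e"
      using sub e by (auto simp: meet_def star_def)
    moreover have "inj_on star e"
      using bij_star sub by (auto simp: bij_betw_def intro: inj_on_subset)
    ultimately show ?thesis by (simp add: card_image)
  qed
  moreover have "card ((meet (cycle_edges N (w b)) (star ` {..<N}))\<inverse> `` {star p}) = 2" if p: "p < N" for p
  proof -
    have "h \<subseteq> {..<N}" if "h \<in> cycle_edges N (w b)" for h using cyc_subset[OF N3 bij[OF assms] that] .
    then have "(meet (cycle_edges N (w b)) (star ` {..<N}))\<inverse> `` {star p} = {h \<in> cycle_edges N (w b). p \<in> h}"
      using p by (fastforce simp: meet_def star_def)
    then show ?thesis using card_cyc_incident[OF N3 bij[OF assms], of p] p by simp
  qed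
  ultimately show ?thesis by (auto simp: biregular_def) (auto simp: meet_def)
qed

lemma biregular_apart_star:
  assumes "b < n"
  shows "biregular (apart (cycle_edges N (w b)) (star ` {..<N})) (cycle_edges N (w b)) (star ` {..<N}) (N - 2)"
proof (rule biregular_apart[OF biregular_meet_star[OF assms]])
  show "card (cycle_edges N (w b)) = N" using bij_betw_same_card[OF bij_edge_w[OF assms]] by simp
  show "card (star ` {..<N}) = N" using bij_betw_same_card[OF bij_star] by simp
qed (simp_all add: cycle_edges_def)

text \<open>\<open>n + 1\<close> blocks give \<open>n\<close> rounds of 4 colours. Two cycle blocks
  need 4 by Koenig's theorem; block \<open>b\<close> and the star block need 2 for their 2-regular
  graph and 2 for the inner cycle of \<open>b\<close> together with the cycle
  \<open>star \<circ> w b\<close> of the clique.\<close>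

lemma edge_colourable_triangular_even:
  assumes "odd n"
  shows "edge_colourable (edges (triangular_graph (Suc N))) (2 * (Suc N - 2))"
proof -
  let ?F = "\<lambda>b c. if b < n
    then cross (meet (cycle_edges N (w b)) (block c)) \<union> (if c < n then {} else cycle_edges N (cycle_edge N (w b)))
    else cycle_edges N (star \<circ> w c)"
  have "edge_colourable (edges (triangular_graph (Suc N))) (\<Sum>r<n. 4)"
  proof (rule edge_colourable_blocks[where B = block and F = ?F])
    show "odd n" by (fact assms)
    show "block b \<inter> block c = {}" if "b \<le> n" "c \<le> n" "b \<noteq> c" for b c
      using that by (rule block_disjoint)
    show "e \<subseteq> block b \<union> block c" if bc: "b \<le> n" "c \<le> n" "b \<noteq> c" "e \<in> ?F b c" for b c e
    proof (cases "b < n")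
      case True
      then show ?thesis
        using bc(4) cross_meet_subset[of e "cycle_edges N (w b)" "block c"] cyc_subset[OF N3 bij_edge_w[OF True], of e]
        by (auto simp: block_def[of b] split: if_splits)
    next
      case False
      then have "b = n" "c < n" using bc by simp_all
      then show ?thesis
        using bc(4) cyc_subset[OF N3 bij_betw_trans[OF bij bij_star], of c e] by (simp add: block_def) blast
    qed
    show "edge_colourable (?F b c \<union> ?F c b) 4" if bc: "b < c" "c \<le> n" for b c
    proof (cases "c < n")
      case True
      then have bcn: "b < n" "c < n" "b \<noteq> c" using bc by simp_all
      then have "?F b c \<union> ?F c b = cross (meet (cycle_edges N (w b)) (cycle_edges N (w c)))"
        using cross_meet_commute[of "cycle_edges N (w c)" "cycle_edges N (w b)"] by (simp add: block_def)
      then show ?thesis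
        using koenig[OF biregular_meet_w[OF bcn] _ _ cyc_disjoint[OF bcn]] by (simp add: cycle_edges_def)
    next
      case False
      then have cn: "c = n" "b < n" using bc by simp_all
      have "edge_colourable (cross (meet (cycle_edges N (w b)) (star ` {..<N})) \<union> cycle_edges N (cycle_edge N (w b)) \<union> cycle_edges N (star \<circ> w b)) (2 + 2)"
      proof (rule edge_colourable_two_cycles_perm[OF oddN N3 bij_edge_w _ cyc_star_disjoint biregular_meet_star])
        show "bij_betw (star \<circ> w b) {..<N} (star ` {..<N})"
          using bij[OF cn(2)] bij_star by (rule bij_betw_trans)
        \<comment> \<open>The identity on positions sends each cycle edge to the star of its first
          point.\<close>
        show "bij_betw (\<lambda>s. s) {..<N} {..<N}" by (simp add: bij_betw_def)
        show "(cycle_edge N (w b) s, (star \<circ> w b) s) \<in> meet (cycle_edges N (w b)) (star ` {..<N})" if "s < N" for s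
        proof -
          have "w b s < N" using bij[OF cn(2)] that by (auto simp: bij_betw_def)
          then show ?thesis using that by (auto simp: meet_def cycle_edges_def star_def cycle_edge_def)
        qed
        show "0 < N" using N3 by simp
      qed (use cn in simp_all)
      then show ?thesis using cn by (simp add: block_def)
    qed
    fix e assume "e \<in> edges (triangular_graph (Suc N))"
    then obtain x y where e: "e = {x, y}" "x \<noteq> y" "x \<inter> y \<noteq> {}"
        "x \<subseteq> {..<Suc N}" "card x = 2" "y \<subseteq> {..<Suc N}" "card y = 2"
      by (rule triangular_edgeE)
    obtain b c where bc: "b \<le> n" "x \<in> block b" "c \<le> n" "y \<in> block c"
      using vertex_block'[OF e(4,5)] vertex_block'[OF e(6,7)] by blast
    consider "b \<noteq> c" "b < n" | "b \<noteq> c" "b = n" "c < n" | "b = c" "b < n" | "b = n" "c = n"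
      using bc(1,3) by linarith
    then show "\<exists>b\<le>n. \<exists>c\<le>n. b \<noteq> c \<and> e \<in> ?F b c"
    proof cases
      case 1
      then have "e \<in> cross (meet (cycle_edges N (w b)) (block c))"
        unfolding e(1) using bc(2,4) e(3) by (intro cross_meetI) (simp_all add: block_def)
      then show ?thesis using 1 bc by (intro exI[of _ b] exI[of _ c] conjI) auto
    next
      case 2
      then have "e \<in> cross (meet (cycle_edges N (w c)) (block b))"
        unfolding e(1) insert_commute[of x y] using bc(2,4) e(3)
        by (intro cross_meetI) (auto simp add: block_def)
      then show ?thesis using 2 bc by (intro exI[of _ c] exI[of _ b] conjI) auto
    next
      case 3
      then have "e \<in> cycle_edges N (cycle_edge N (w b))"
        using meeting_in_block[of b x y] bc(2,4) e by (simp add: block_def)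
      then show ?thesis using 3 by (intro exI[of _ b] exI[of _ n] conjI) auto
    next
      case 4
      then obtain s t where st: "s < N" "x = star s" "t < N" "y = star t"
        using bc(2,4) by (auto simp: block_def)
      then obtain i where i: "i < n" "{s, t} \<in> cycle_edges N (w i)" using cover[of s t] e(2) by auto
      have "e \<in> cycle_edges N (star \<circ> w i)" using cyc_comp[OF i(2), of star] st e(1) by simp
      then show ?thesis using i(1) by (intro exI[of _ n] exI[of _ i] conjI) auto
    qed
  qed
  then show ?thesis by (simp add: N mult.commute)
qed

text \<open>Any two stars meet in \<open>N\<close>, so the star block has no inner edges and
  Koenig's theorem settles its pairs. The \<open>n\<close> rounds use \<open>n * (2 * n - 1)\<close>
  colours, which is \<open>(2 * n) choose 2\<close>.\<close>

lemma edge_colourable_complement_even: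
  assumes "odd n" kneser_colourable
  shows "edge_colourable (edges (graph_complement (triangular_graph (Suc N)))) ((Suc N - 2) choose 2)"
proof -
  let ?F = "\<lambda>b c. if b < n then (if c < n then kneser_part b c else cross (apart (cycle_edges N (w b)) (star ` {..<N}))) else {}"
  have "edge_colourable (edges (graph_complement (triangular_graph (Suc N)))) (\<Sum>r<n. N - 2)"
  proof (rule edge_colourable_blocks[where B = block and F = ?F])
    show "odd n" by (fact assms)
    show "block b \<inter> block c = {}" if "b \<le> n" "c \<le> n" "b \<noteq> c" for b c
      using that by (rule block_disjoint)
    show "e \<subseteq> block b \<union> block c" if bc: "b \<le> n" "c \<le> n" "b \<noteq> c" "e \<in> ?F b c" for b c e
      using bc kneser_part_subset[of b e c] cross_apart_subset[of e "cycle_edges N (w b)" "star ` {..<N}"]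
      by (auto simp: block_def split: if_splits)
    show "edge_colourable (?F b c \<union> ?F c b) (N - 2)" if bc: "b < c" "c \<le> n" for b c
    proof (cases "c < n")
      case True
      then have "edge_colourable (kneser_part b c \<union> kneser_part c b) (N - 2)"
        using assms(2) bc(1) unfolding kneser_colourable_def by blast
      then show ?thesis using True bc by simp
    next
      case False
      then have cn: "c = n" "b < n" using bc by simp_all
      then show ?thesis
        using koenig[OF biregular_apart_star[OF cn(2)] _ _ cyc_star_disjoint[OF cn(2)]] by (simp add: cycle_edges_def)
    qed
    fix e assume "e \<in> edges (graph_complement (triangular_graph (Suc N)))"
    then obtain x y where e: "e = {x, y}" "x \<noteq> y" "x \<inter> y = {}"
        "x \<subseteq> {..<Suc N}" "card x = 2" "y \<subseteq> {..<Suc N}" "card y = 2"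
      by (rule complement_triangular_edgeE)
    obtain b c where bc: "b \<le> n" "x \<in> block b" "c \<le> n" "y \<in> block c"
      using vertex_block'[OF e(4,5)] vertex_block'[OF e(6,7)] by blast
    have "\<not> (b = n \<and> c = n)"
      using bc(2,4) e(3) by (auto simp: block_def star_def)
    then consider "b \<noteq> c" "b < n" "c < n" | "b < n" "c = n" | "b = n" "c < n" | "b = c" "b < n"
      using bc(1,3) by linarith
    then show "\<exists>b\<le>n. \<exists>c\<le>n. b \<noteq> c \<and> e \<in> ?F b c"
    proof cases
      case 1
      then have "e \<in> kneser_part b c"
        using cross_apartI[of x "cycle_edges N (w b)" y "cycle_edges N (w c)"] bc(2,4) e(1,3)
        unfolding kneser_part_def block_def by simp
      then show ?thesis using 1 by (intro exI[of _ b] exI[of _ c] conjI) auto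
    next
      case 2
      then have "e \<in> cross (apart (cycle_edges N (w b)) (star ` {..<N}))"
        unfolding e(1) using bc(2,4) e(3) by (intro cross_apartI) (simp_all add: block_def)
      then show ?thesis using 2 by (intro exI[of _ b] exI[of _ c] conjI) auto
    next
      case 3
      then have "e \<in> cross (apart (cycle_edges N (w c)) (star ` {..<N}))"
        unfolding e(1) insert_commute[of x y] using bc(2,4) e(3)
        by (intro cross_apartI) (auto simp add: block_def)
      then show ?thesis using 3 by (intro exI[of _ c] exI[of _ b] conjI) auto
    next
      case 4
      then obtain d where "d < n" "b \<noteq> d" "e \<in> kneser_part b d"
        using apart_in_kneser_part[of b x y] bc(2,4) e by (auto simp: block_def)
      then show ?thesis using 4 by (intro exI[of _ b] exI[of _ d] conjI) auto
    qed
  qed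
  moreover have "(\<Sum>r<n. N - 2) = (Suc N - 2) choose 2"
    by (simp add: choose_two N)
  ultimately show ?thesis by simp
qed

end

section \<open>Hamiltonian decompositions of complete graphs\<close>

text \<open>Walecki's construction: the zigzag \<open>0, 1, -1, 2, -2, \<dots>, n\<close> modulo \<open>2 * n\<close>, closed up by the point
  at infinity \<open>2 * n\<close>, and its rotations. Consecutive points of the \<open>i\<close>-th rotation have sum \<open>2 * i\<close> or
  \<open>2 * i + 1\<close>, so the sum of two points tells the cycle that contains them.\<close>

definition zigzag :: "nat \<Rightarrow> nat \<Rightarrow> nat" where
  "zigzag n t = (if odd t then Suc t div 2 else if t = 0 then 0 else 2 * n - t div 2)"

lemma zigzag_less: "n > 0 \<Longrightarrow> t < 2 * n \<Longrightarrow> zigzag n t < 2 * n"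
  by (auto simp: zigzag_def)

text \<open>Odd positions take the values \<open>1, ..., n\<close> and even ones the values 0 and
  \<open>n + 1, ..., 2 * n - 1\<close>.\<close>

lemma zigzag_inj: "s < 2 * n \<Longrightarrow> t < 2 * n \<Longrightarrow> zigzag n s = zigzag n t \<Longrightarrow> s = t"
  by (auto simp: zigzag_def elim!: oddE evenE split: if_splits)

text \<open>As \<open>a < b < 2 * n\<close>, the sum can only be 1, \<open>2 * n\<close> or
  \<open>2 * n + 1\<close>, and for a given sum \<open>a\<close> determines the position on the
  zigzag.\<close>

lemma zigzag_adjacent:
  assumes ab: "a < b" "b < 2 * n" "(a + b) mod (2 * n) < 2"
  shows "\<exists>t. Suc t < 2 * n \<and> {a, b} = {zigzag n t, zigzag n (Suc t)}"
proof -
  have "a + b < 2 \<or> a + b = 2 * n \<or> a + b = 2 * n + 1"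
  proof (cases "a + b < 2 * n")
    case False
    then have "(a + b) mod (2 * n) = a + b - 2 * n"
      using ab(1,2) by (simp add: mod_if)
    then show ?thesis using ab(3) False by linarith
  qed (use ab(3) in simp)
  then consider "a + b < 2" | "a + b = 2 * n" | "a + b = 2 * n + 1" by blast
  then show ?thesis
  proof cases
    case 1
    then show ?thesis using ab by (intro exI[of _ 0]) (auto simp: zigzag_def)
  next
    case 2
    then obtain c where c: "a = Suc c" using ab by (cases a) auto
    \<comment> \<open>\<open>a\<close> sits at position \<open>2 * c + 1\<close> and
      \<open>b\<close> right after it; in the last case \<open>b\<close> comes first, at position
      \<open>2 * c + 2\<close>.\<close>
    have "Suc (2 * c + 1) < 2 * n" "b = 2 * n - Suc c" using 2 c ab by auto
    then show ?thesis using c by (intro exI[of _ "2 * c + 1"]) (simp add: zigzag_def)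
  next
    case 3
    then have "a \<ge> 2" using ab by linarith
    then obtain c where c: "a = Suc (Suc c)" using le_Suc_ex[of 2 a] by auto
    have "Suc (2 * c + 2) < 2 * n" "b = 2 * n - Suc c" using 3 c ab by auto
    then show ?thesis using c by (intro exI[of _ "2 * c + 2"]) (auto simp: zigzag_def)
  qed
qed

definition walecki :: "nat \<Rightarrow> nat \<Rightarrow> nat \<Rightarrow> nat" where
  "walecki n i t = (if t < 2 * n then (i + zigzag n t) mod (2 * n) else 2 * n)"

lemma bij_walecki:
  assumes "n > 0"
  shows "bij_betw (walecki n i) {..<Suc (2 * n)} {..<Suc (2 * n)}"
proof -
  have "inj_on (walecki n i) {..<Suc (2 * n)}"
  proof (rule inj_onI)
    fix s t assume st: "s \<in> {..<Suc (2 * n)}" "t \<in> {..<Suc (2 * n)}" "walecki n i s = walecki n i t"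
    have lt: "(i + z) mod (2 * n) < 2 * n" for z using assms by simp
    show "s = t"
    proof (cases "s < 2 * n")
      case True
      then have "t < 2 * n" using st(3) lt[of "zigzag n s"] by (auto simp: walecki_def split: if_splits)
      with True st(3) have "(i + zigzag n s) mod (2 * n) = (i + zigzag n t) mod (2 * n)"
        by (simp add: walecki_def)
      then have "zigzag n s = zigzag n t"
        by (rule add_mod_eqD[OF zigzag_less[OF assms True] zigzag_less[OF assms \<open>t < 2 * n\<close>]])
      then show ?thesis using zigzag_inj True \<open>t < 2 * n\<close> by blast
    next
      case False
      then have "\<not> t < 2 * n" using st(3) lt[of "zigzag n t"] by (auto simp: walecki_def split: if_splits)
      then show ?thesis using False st(1,2) by simp
    qed
  qed
  moreover have "walecki n i ` {..<Suc (2 * n)} \<subseteq> {..<Suc (2 * n)}"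
    using assms by (auto simp: walecki_def less_Suc_eq)
  ultimately show ?thesis by (simp add: bij_betw_def endo_inj_surj)
qed

text \<open>The \<open>i\<close>-th zigzag has the ends \<open>i\<close> and \<open>i + n\<close>,
  which settles the pairs with the point \<open>2 * n\<close>. Two finite points lie on the cycle
  whose index is half their sum modulo \<open>2 * n\<close>, rounded down.\<close>

lemma walecki_cover_less:
  assumes n: "n > 0" and xy: "x < y" "y < Suc (2 * n)"
  shows "\<exists>i<n. {x, y} \<in> cycle_edges (Suc (2 * n)) (walecki n i)"
proof (cases "y = 2 * n")
  case True
  show ?thesis
  proof (cases "x < n")
    case True
    have "cycle_edge (Suc (2 * n)) (walecki n x) (2 * n) = {2 * n, x}"
      using True n by (simp add: cycle_edge_def walecki_def zigzag_def)
    then show ?thesis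
      using True \<open>y = 2 * n\<close> by (intro exI[of _ x]) (auto simp: cycle_edges_def insert_commute)
  next
    case False
    have "odd (2 * n - 1)" "2 * n - 1 < 2 * n" "Suc (2 * n - 1) = 2 * n" using n by simp_all
    then have "cycle_edge (Suc (2 * n)) (walecki n (x - n)) (2 * n - 1) = {x, 2 * n}"
      using False xy \<open>y = 2 * n\<close> by (simp add: cycle_edge_def walecki_def zigzag_def)
    moreover have "cycle_edge (Suc (2 * n)) (walecki n (x - n)) (2 * n - 1) \<in> cycle_edges (Suc (2 * n)) (walecki n (x - n))"
      by (simp add: cycle_edges_def)
    moreover have "x - n < n" using xy \<open>y = 2 * n\<close> False by linarith
    ultimately show ?thesis using \<open>y = 2 * n\<close> by auto
  qed
next
  case False
  then have y: "y < 2 * n" and x: "x < 2 * n" using xy by simp_all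
  define s where "s = (x + y) mod (2 * n)"
  define i where "i = s div 2"
  have "s < 2 * n" using n by (simp add: s_def)
  then have i: "i < n" "2 * i \<le> s" "s - 2 * i < 2" by (simp_all add: i_def)
  \<comment> \<open>Rotating back by \<open>i\<close> turns the sum into \<open>s - 2 * i\<close>,
    which is 0 or 1, so the points become neighbours on the basic zigzag; \<open>2 * n - i\<close>
    stands for \<open>-i\<close>.\<close>
  define a where "a = (x + (2 * n - i)) mod (2 * n)"
  define b where "b = (y + (2 * n - i)) mod (2 * n)"
  have shift_back: "(i + (z + (2 * n - i)) mod (2 * n)) mod (2 * n) = z" if "z < 2 * n" for z
  proof -
    have "(i + (z + (2 * n - i)) mod (2 * n)) mod (2 * n) = (i + (z + (2 * n - i))) mod (2 * n)"
      by (simp add: mod_add_right_eq)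
    also have "i + (z + (2 * n - i)) = z + 2 * n" using i(1) by simp
    finally show ?thesis using that by simp
  qed
  have xa: "(i + a) mod (2 * n) = x" and yb: "(i + b) mod (2 * n) = y"
    using shift_back x y by (simp_all add: a_def b_def)
  have ab: "a < 2 * n" "b < 2 * n" "a \<noteq> b"
    using n xa yb xy(1) by (auto simp: a_def b_def)
  have "(a + b) mod (2 * n) = ((x + (2 * n - i)) + (y + (2 * n - i))) mod (2 * n)"
    by (simp add: a_def b_def mod_add_eq)
  also have "(x + (2 * n - i)) + (y + (2 * n - i)) = (x + y) + (4 * n - 2 * i)" using i(1) by simp
  also have "\<dots> mod (2 * n) = (s + (4 * n - 2 * i)) mod (2 * n)" by (simp add: s_def mod_add_left_eq)
  also have "s + (4 * n - 2 * i) = s - 2 * i + 2 * (2 * n)" using i by simp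
  also have "\<dots> mod (2 * n) = (s - 2 * i) mod (2 * n)" by (rule mod_mult_self1)
  also have "\<dots> = s - 2 * i" using \<open>s < 2 * n\<close> by simp
  finally have sum: "(a + b) mod (2 * n) < 2" using i(3) by simp
  have "\<exists>t. Suc t < 2 * n \<and> {a, b} = {zigzag n t, zigzag n (Suc t)}"
  proof (cases "a < b")
    case True
    then show ?thesis using zigzag_adjacent ab sum by blast
  next
    case False
    then show ?thesis
      using zigzag_adjacent[of b a n] ab sum by (simp add: insert_commute add.commute)
  qed
  then obtain t where t: "Suc t < 2 * n" "{a, b} = {zigzag n t, zigzag n (Suc t)}" by blast
  have "{x, y} = (\<lambda>z. (i + z) mod (2 * n)) ` {a, b}" by (simp add: xa yb)
  also have "\<dots> = cycle_edge (Suc (2 * n)) (walecki n i) t"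
    unfolding t(2) using t(1) by (simp add: cycle_edge_def walecki_def)
  finally show ?thesis using i(1) t(1) by (auto simp: cycle_edges_def)
qed

text \<open>Relabelling the points by the inverse of cycle 0 makes that cycle the identity, as the
  locale requires.\<close>

lemma hamilton_decomposition_exists:
  assumes n: "n > 0"
  shows "\<exists>w. hamilton_decomposition (Suc (2 * n)) n w"
proof -
  let ?N = "Suc (2 * n)"
  let ?inv = "inv_into {..<?N} (walecki n 0)"
  note W0 = bij_walecki[OF n, of 0]
  have inv: "?inv (walecki n 0 x) = x" and less: "walecki n 0 x < ?N" if "x < ?N" for x
    using W0 that by (auto simp: bij_betw_def)
  have "hamilton_decomposition ?N n (\<lambda>i. ?inv \<circ> walecki n i)"
  proof
    show "bij_betw (?inv \<circ> walecki n i) {..<?N} {..<?N}" for i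
      using bij_walecki[OF n] bij_betw_inv_into[OF W0] by (rule bij_betw_trans)
    show "(?inv \<circ> walecki n 0) t = t" if "t < ?N" for t using inv[OF that] by simp
    fix x y assume xy: "x < ?N" "y < ?N" "x \<noteq> y"
    let ?x = "walecki n 0 x" and ?y = "walecki n 0 y"
    have "?x \<noteq> ?y" using inv xy by metis
    then consider "?x < ?y" | "?y < ?x" by linarith
    then have "\<exists>i<n. {?x, ?y} \<in> cycle_edges ?N (walecki n i)"
    proof cases
      case 1
      then show ?thesis using walecki_cover_less[OF n _ less[OF xy(2)]] by blast
    next
      case 2
      then show ?thesis
        using walecki_cover_less[OF n _ less[OF xy(1)]] insert_commute[of ?x ?y] by simp
    qed
    then obtain i where i: "i < n" "{?x, ?y} \<in> cycle_edges ?N (walecki n i)" by blast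
    then show "\<exists>i<n. {x, y} \<in> cycle_edges ?N (?inv \<circ> walecki n i)"
      using cyc_comp[OF i(2), of ?inv] inv xy by auto
  qed (use n in simp_all)
  then show ?thesis by blast
qed

text \<open>For \<open>N = 7\<close> the counting argument in \<open>edge_colourable_apart_cycles\<close> fails. The decomposition of the
  complete graph on \<open>\<int>/7\<close> by the differences 1, 2, 4 is used instead, with matchings (the permutations in
  \<open>kneser_colourable_seven\<close>) found by computer search.\<close>

definition seven :: "nat \<Rightarrow> nat \<Rightarrow> nat" where
  "seven i t = 2 ^ i * t mod 7"

lemma less_7_cases:
  assumes "(t::nat) < 7"
  obtains "t = 0" | "t = 1" | "t = 2" | "t = 3" | "t = 4" | "t = 5" | "t = 6"
  using assms by linarith

lemma bij_seven: "bij_betw (seven i) {..<7} {..<7}"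
proof -
  have cop: "coprime (7::nat) (2 ^ i)" by simp
  have le: "s = t" if "s < 7" "t < 7" "seven i s = seven i t" "s \<le> t" for s t
  proof -
    have "7 dvd 2 ^ i * (t - s)"
      using that(3,4) mod_eq_dvd_iff_nat[of "2 ^ i * s" "2 ^ i * t" 7]
      by (simp add: seven_def right_diff_distrib')
    then have "7 dvd t - s" using coprime_dvd_mult_right_iff[OF cop] by blast
    then show ?thesis using that by (auto dest: dvd_imp_le)
  qed
  have "inj_on (seven i) {..<7}"
  proof (rule inj_onI)
    fix s t assume "s \<in> {..<7}" "t \<in> {..<7}" "seven i s = seven i t"
    then show "s = t" using le[of s t] le[of t s] by (cases "s \<le> t") simp_all
  qed
  moreover have "seven i ` {..<7} \<subseteq> {..<7}" by (auto simp: seven_def)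
  ultimately show ?thesis by (simp add: bij_betw_def endo_inj_surj)
qed

lemma seven_step:
  assumes "x < 7"
  shows "{x, (x + 2 ^ i) mod 7} \<in> cycle_edges 7 (seven i)"
proof -
  obtain t where t: "t < 7" "seven i t = x"
    using bij_betw_imp_surj_on[OF bij_seven[of i]] assms by (metis imageE lessThan_iff)
  have "seven i (Suc t mod 7) = (2 ^ i * t + 2 ^ i) mod 7"
    by (simp add: seven_def mod_mult_right_eq add.commute)
  also have "\<dots> = (x + 2 ^ i) mod 7"
    unfolding t(2)[symmetric] by (simp add: seven_def mod_add_left_eq)
  finally have "cycle_edge 7 (seven i) t = {x, (x + 2 ^ i) mod 7}" using t(2) by (simp add: cycle_edge_def)
  then show ?thesis using t(1) by (auto simp: cycle_edges_def)
qed

lemma hamilton_decomposition_seven: "hamilton_decomposition 7 3 seven"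
proof
  show "bij_betw (seven i) {..<7} {..<7}" for i by (rule bij_seven)
  show "\<exists>i<3. {x, y} \<in> cycle_edges 7 (seven i)" if xy: "x < 7" "y < 7" "x \<noteq> y" for x y
  proof -
    \<comment> \<open>1, 2, 4 and their negatives are all the nonzero residues modulo 7.\<close>
    have "(y = (x + 1) mod 7 \<or> y = (x + 2) mod 7 \<or> y = (x + 4) mod 7) \<or>
        (x = (y + 1) mod 7 \<or> x = (y + 2) mod 7 \<or> x = (y + 4) mod 7)"
      using xy by (elim less_7_cases) simp_all
    moreover have "(2::nat) ^ 0 = 1" "(2::nat) ^ 1 = 2" "(2::nat) ^ 2 = 4"
      "(0::nat) < 3" "(1::nat) < 3" "(2::nat) < 3" by simp_all
    ultimately obtain i where i: "i < 3" "y = (x + 2 ^ i) mod 7 \<or> x = (y + 2 ^ i) mod 7"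
      by metis
    then show ?thesis
      using seven_step[OF xy(1), of i] seven_step[OF xy(2), of i] by (auto simp: insert_commute)
  qed
qed (simp_all add: seven_def)

interpretation seven: hamilton_decomposition 7 3 seven
  by (fact hamilton_decomposition_seven)

lemma seven_part:
  assumes bc: "b < 3" "c < 3" "b \<noteq> c"
    and p: "bij_betw p {..<7} {..<7}" "t < 7" "p (Suc t mod 7) = Suc (p t) mod 7"
    and disj: "\<And>s. s < 7 \<Longrightarrow> cycle_edge 7 (seven b) (seven ((c + 3 - b) mod 3) s) \<inter>
      cycle_edge 7 (seven c) (seven ((b + 3 - c) mod 3) (p s)) = {}"
  shows "edge_colourable (seven.kneser_part b c \<union> seven.kneser_part c b) 5"
proof -
  let ?f = "cycle_edge 7 (seven b) \<circ> seven ((c + 3 - b) mod 3)"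
  let ?g = "cycle_edge 7 (seven c) \<circ> seven ((b + 3 - c) mod 3)"
  have f: "bij_betw ?f {..<7} (cycle_edges 7 (seven b))" and g: "bij_betw ?g {..<7} (cycle_edges 7 (seven c))"
    using bc by (simp_all add: seven.bij_edge_comp)
  have "(?f s, ?g (p s)) \<in> apart (cycle_edges 7 (seven b)) (cycle_edges 7 (seven c))" if "s < 7" for s
  proof -
    have "p s < 7" using p(1) that by (auto simp: bij_betw_def)
    then show ?thesis
      using bij_betwE[OF f] bij_betwE[OF g] disj[OF that] that by (simp add: apart_def)
  qed
  then have "edge_colourable (seven.kneser_part b c \<union> seven.kneser_part c b) (7 - 4 + 2)"
    unfolding seven.kneser_part_Un
    using edge_colourable_two_cycles_perm[OF seven.oddN seven.N3 f g seven.cyc_disjoint[OF bc]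
      seven.biregular_apart_w[OF bc] p(1) _ p(2,3)] by blast
  then show ?thesis by simp
qed

lemma kneser_colourable_seven: "seven.kneser_colourable"
  unfolding seven.kneser_colourable_def
proof (intro allI impI)
  fix b c :: nat assume "b < c" "c < 3"
  \<comment> \<open>\<open>?p\<close> sends 4, 5 to 5, 6 and \<open>?p'\<close> sends 0, 1 to 2, 3,
    which gives the required consecutive positions. \<open>?p\<close> serves two pairs of blocks
    because doubling modulo 7 carries the pair (0, 1) to (1, 2).\<close>
  let ?p = "\<lambda>s. [2, 4, 0, 3, 5, 6, 1::nat] ! s" and ?p' = "\<lambda>s. [2, 3, 6, 0, 1, 4, 5::nat] ! s"
  have set7: "{..<7} = {0, 1, 2, 3, 4, 5, 6::nat}" by (auto elim: less_7_cases)
  have p: "bij_betw ?p {..<7} {..<7}" "bij_betw ?p' {..<7} {..<7}"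
    unfolding set7 by (auto simp: bij_betw_def)
  consider "b = 0" "c = 1" | "b = 1" "c = 2" | "b = 0" "c = 2"
    using \<open>b < c\<close> \<open>c < 3\<close> by linarith
  then have "edge_colourable (seven.kneser_part b c \<union> seven.kneser_part c b) 5"
  proof cases
    case 1
    then show ?thesis
      by (intro seven_part[where p = ?p and t = 4] p; (elim less_7_cases)?) (simp_all add: cycle_edge_def seven_def)
  next
    case 2
    then show ?thesis
      by (intro seven_part[where p = ?p and t = 4] p; (elim less_7_cases)?) (simp_all add: cycle_edge_def seven_def)
  next
    case 3
    then show ?thesis
      by (intro seven_part[where p = ?p' and t = 0] p; (elim less_7_cases)?) (simp_all add: cycle_edge_def seven_def)
  qed
  then show "edge_colourable (seven.kneser_part b c \<union> seven.kneser_part c b) (7 - 2)" by simp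
qed

text \<open>For \<open>n = 1\<close> there are no two cycle blocks, and \<open>n \<ge> 4\<close>
  gives \<open>N \<ge> 9\<close>. The excluded \<open>n = 2\<close> belongs to \<open>m = 5\<close>,
  where the complement is the Petersen graph, which has chromatic index 4.\<close>

lemma kneser_colourable_exists:
  assumes "n > 0" "n \<noteq> 2"
  shows "\<exists>w. hamilton_decomposition (Suc (2 * n)) n w \<and>
    hamilton_decomposition.kneser_colourable (Suc (2 * n)) n w"
proof -
  consider "n = 1" | "n = 3" | "n \<ge> 4" using assms by linarith
  then show ?thesis
  proof cases
    case 2
    then have "Suc (2 * n) = 7" by simp
    then show ?thesis
      using 2 hamilton_decomposition_seven kneser_colourable_seven by auto
  next
    case 1
    obtain w where w: "hamilton_decomposition (Suc (2 * n)) n w"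
      using hamilton_decomposition_exists[OF assms(1)] by blast
    then show ?thesis using 1 hamilton_decomposition.kneser_colourable_def[OF w] by auto
  next
    case 3
    obtain w where w: "hamilton_decomposition (Suc (2 * n)) n w"
      using hamilton_decomposition_exists[OF assms(1)] by blast
    then show ?thesis using 3 hamilton_decomposition.kneser_colourableI[OF w] by auto
  qed
qed

theorem theorem3p3:
  fixes m :: nat
  assumes "m \<ge> 2" and "m mod 4 = 0 \<or> m mod 4 = 1"
  shows "class_1 (triangular_graph m) \<and>
         (m \<noteq> 5 \<longrightarrow> class_1 (graph_complement (triangular_graph m)))"
proof -
  \<comment> \<open>\<open>m\<close> is \<open>2 * n + 1\<close> for residue 1 and
    \<open>2 * n + 2\<close> for residue 0; in both cases the number of blocks, \<open>n\<close> or
    \<open>n + 1\<close>, is even.\<close>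
  define n where "n = (m - 1) div 2"
  have "n > 0 \<and> (m = Suc (2 * n) \<and> even n \<or> m = Suc (Suc (2 * n)) \<and> odd n)"
    unfolding n_def using assms by presburger
  then have n: "n > 0" and m: "m = Suc (2 * n) \<and> even n \<or> m = Suc (Suc (2 * n)) \<and> odd n" by simp_all
  have "edge_colourable (edges (triangular_graph m)) (2 * (m - 2))"
  proof -
    obtain w where w: "hamilton_decomposition (Suc (2 * n)) n w"
      using hamilton_decomposition_exists[OF n] by blast
    show ?thesis
      using m hamilton_decomposition.edge_colourable_triangular_odd[OF w]
        hamilton_decomposition.edge_colourable_triangular_even[OF w] by blast
  qed
  moreover have "edge_colourable (edges (graph_complement (triangular_graph m))) ((m - 2) choose 2)" if "m \<noteq> 5"
  proof -
    have "n \<noteq> 2" using that m by auto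
    then obtain w where w: "hamilton_decomposition (Suc (2 * n)) n w"
        "hamilton_decomposition.kneser_colourable (Suc (2 * n)) n w"
      using kneser_colourable_exists[OF n] by blast
    show ?thesis
      using m hamilton_decomposition.edge_colourable_complement_odd[OF w(1) _ w(2)]
        hamilton_decomposition.edge_colourable_complement_even[OF w(1) _ w(2)] by blast
  qed
  ultimately show ?thesis
    using triangular_class_1I[OF assms(1)] complement_triangular_class_1I[OF assms(1)] by blast
qed

end
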